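(* For all natural numbers $N, S$ and every prime number $p$, there exists $T \in \mathbb{N}$ with the following property: for every knot $K$ such that the reduction of $P_K(a,N)$ modulo $p$ (an element of $\mathbb{F}_p[a^{\pm1}]$) has $a$-span at most $S$, there exists a knot $K'$ with braid index $b(K') \le T$ and $P_{K'}(a,N) \equiv P_K(a,N) \pmod p$.
   Context: $P_K(a,z)$ denotes the HOMFLY polynomial of a link $K$, normalised so that the trivial knot has $P=1$ and satisfying $a^{-1} P_{\widehat{\beta \sigma_i^2}} - a P_{\widehat{\beta}} = z P_{\widehat{\beta\sigma_i}}$ for all braids $\beta\in B_n$ and generators $\sigma_i$, where the hat denotes braid closure. For knots, $P_K(a,z)$ is a polynomial in $z$, so $P_K(a,N)\in\mathbb{Z}[a^{\pm1}]$. The $a$-span of a nonzero Laurent polynomial in $a$ is the difference between its maximal and minimal $a$-degrees. $b(K)$ denotes the braid index of $K$, i.e. the minimal number of strands of a braid whose closure is $K$. *)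

theory Defs
  imports Main "HOL-Computational_Algebra.Primes"
begin

text \<open>Braid words.  A letter k (k \<noteq> 0) stands for the Artin generator
  sigma_|k| raised to the power sign k.  A braid on n strands is a word
  with letters among sigma_1, ..., sigma_(n-1) and their inverses.\<close>

type_synonym braid_word = "int list"

definition valid_braid :: "nat \<Rightarrow> braid_word \<Rightarrow> bool" where
  "valid_braid n w \<longleftrightarrow> n \<ge> 1 \<and> (\<forall>k\<in>set w. k \<noteq> 0 \<and> \<bar>k\<bar> < int n)"

inductive braid_basic :: "braid_word \<Rightarrow> braid_word \<Rightarrow> bool" where
  cancel1: "k > 0 \<Longrightarrow> braid_basic [k, -k] []"
| cancel2: "k > 0 \<Longrightarrow> braid_basic [-k, k] []"
| far: "i > 0 \<Longrightarrow> j > 0 \<Longrightarrow> \<bar>i - j\<bar> \<ge> 2 \<Longrightarrow> braid_basic [i, j] [j, i]"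
| braid: "i > 0 \<Longrightarrow> braid_basic [i, i + 1, i] [i + 1, i, i + 1]"

inductive braid_equiv :: "braid_word \<Rightarrow> braid_word \<Rightarrow> bool" where
  basic: "braid_basic x y \<Longrightarrow> braid_equiv (u @ x @ v) (u @ y @ v)"
| refl: "braid_equiv w w"
| sym: "braid_equiv w v \<Longrightarrow> braid_equiv v w"
| trans: "braid_equiv u v \<Longrightarrow> braid_equiv v w \<Longrightarrow> braid_equiv u w"

text \<open>Laurent polynomials in a, z with integer coefficients are represented by
  their finitely supported coefficient functions: c i j is the coefficient
  of a^i z^j.\<close>
type_synonym laurent2 = "int \<Rightarrow> int \<Rightarrow> int"

definition laurent_one :: laurent2 where
  "laurent_one = (\<lambda>i j. if i = 0 \<and> j = 0 then 1 else 0)"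

text \<open>Characterisation of the HOMFLY polynomial, as a function of braids (n, w):
  invariance of the closure under Markov moves (braid group equality,
  conjugation, stabilisation), the skein relation
  a^-1 P(beta sigma_i^2) - a P(beta) = z P(beta sigma_i), normalisation
  P(unknot) = 1, values in Z[a^+-1, z^+-1], and zero on non-braids.\<close>
definition is_homfly :: "(nat \<Rightarrow> braid_word \<Rightarrow> laurent2) \<Rightarrow> bool" where
  "is_homfly P \<longleftrightarrow>
     (\<forall>n w. \<not> valid_braid n w \<longrightarrow> P n w = (\<lambda>i j. 0)) \<and>
     (\<forall>n w. valid_braid n w \<longrightarrow> finite {(i, j). P n w i j \<noteq> 0}) \<and>
     (\<forall>n w v. valid_braid n w \<and> valid_braid n v \<and> braid_equiv w v \<longrightarrow> P n w = P n v) \<and>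
     (\<forall>n u v. valid_braid n (u @ v) \<longrightarrow> P n (u @ v) = P n (v @ u)) \<and>
     (\<forall>n w. valid_braid n w \<longrightarrow>
        P (n + 1) (w @ [int n]) = P n w \<and> P (n + 1) (w @ [- int n]) = P n w) \<and>
     (\<forall>n w i. valid_braid n w \<and> 1 \<le> i \<and> i < int n \<longrightarrow>
        (\<forall>k l. P n (w @ [i, i]) (k + 1) l - P n w (k - 1) l = P n (w @ [i]) k (l - 1))) \<and>
     P 1 [] = laurent_one"

definition homfly :: "nat \<Rightarrow> braid_word \<Rightarrow> laurent2" where
  "homfly = (THE P. is_homfly P)"

text \<open>Permutation of {0..n-1} induced by a braid word; the closure of the
  braid is a knot iff this permutation is a single n-cycle.\<close>
definition letter_perm :: "int \<Rightarrow> nat \<Rightarrow> nat" where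
  "letter_perm k = (\<lambda>x. if x = nat \<bar>k\<bar> - 1 then nat \<bar>k\<bar>
     else if x = nat \<bar>k\<bar> then nat \<bar>k\<bar> - 1 else x)"

definition braid_perm :: "braid_word \<Rightarrow> nat \<Rightarrow> nat" where
  "braid_perm w = foldr (\<lambda>k f. letter_perm k \<circ> f) w id"

definition is_knot_braid :: "nat \<Rightarrow> braid_word \<Rightarrow> bool" where
  "is_knot_braid n w \<longleftrightarrow> valid_braid n w \<and>
     (\<forall>j < n. \<exists>m. (braid_perm w ^^ m) 0 = j)"

text \<open>P_K(a, N) in Z[a^+-1]: coefficient of a^i.  (For knots P_K has no negative
  powers of z, so only j \<ge> 0 occurs.)\<close>
definition homfly_at :: "nat \<Rightarrow> nat \<Rightarrow> braid_word \<Rightarrow> int \<Rightarrow> int" where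
  "homfly_at N n w i = (\<Sum>j\<in>{j. j \<ge> 0 \<and> homfly n w i j \<noteq> 0}. homfly n w i j * int N ^ nat j)"

definition nonzero_mod :: "nat \<Rightarrow> (int \<Rightarrow> int) \<Rightarrow> bool" where
  "nonzero_mod p f \<longleftrightarrow> (\<exists>i. f i mod int p \<noteq> 0)"

definition a_span_mod :: "nat \<Rightarrow> (int \<Rightarrow> int) \<Rightarrow> int" where
  "a_span_mod p f = Max {i. f i mod int p \<noteq> 0} - Min {i. f i mod int p \<noteq> 0}"

end

(* The skein relation iterated on knots reads
   P(w s^4) = a^2 (z^2 + 2) P(w s^2) - a^4 P(w).
   At z = N and modulo p, the rescaled sequence a^(-2t) P(w s^(2t)) thus satisfies a linear recurrence of
   order two with invertible last coefficient over a finite ring, so it is periodic with a period L that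
   depends only on N and p: adding 2L crossings multiplies P by a^(2L) and keeps the number of strands.
   Up to such shifts only finitely many polynomials have span at most S, and it suffices to realise
   each of them once.

   For this the HOMFLY polynomial must be known to exist, to be unique, and to have no negative powers
   of z on knots.  All three use that every closed braid reduces to the unknot by Markov moves and
   skein relations.  Existence: the R-matrix invariants of gl(m) give the values of P at a = q^(-m) and
   z = q - 1/q; by that reduction these are values of a Laurent polynomial, which they determine. *)

theory Submission
  imports Defs "HOL-Library.FuncSet" "HOL-Computational_Algebra.Polynomial"
    "HOL-Combinatorics.Cycles" Complex_Main
begin

section \<open>Reduction of closed braids to the unknot\<close>

text \<open>\<open>homfly\<close> is a definite description, so nothing can be said of it before
  existence and uniqueness are known. The reduction to the unknot alone does not give existence: a
  braid reduces in many ways, and nothing shows that the results agree. The real-valued trace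
  invariants involve no choices and settle this: any reduction yields a Laurent polynomial with
  their values, and the values pin it down because a = q^(-m) takes infinitely many values for fixed
  q. A second obstacle is that \<open>homfly_at\<close> silently drops negative powers of z.
  Evaluation respects multiplication by z only where none occur; hence the bound on the z-degree by
  the number of components, and a recurrence that adds crossings in pairs, so that the closure stays
  a knot. Shifts come in multiples of the period, so the lowest a-degree can be normalised only up
  to a residue; the finite window of the final argument is therefore longer than S. The bound T is
  not computed: it adds up least strand numbers.\<close>

definition skein_closed :: "(braid_word \<Rightarrow> bool) \<Rightarrow> bool" where
  "skein_closed R \<longleftrightarrow>
     (\<forall>x y i j. i > 0 \<and> j > 0 \<and> \<bar>i - j\<bar> \<ge> 2 \<and> R (x @ [i, j] @ y) \<longrightarrow> R (x @ [j, i] @ y)) \<and>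
     (\<forall>x y i. i > 0 \<and> R (x @ [i, i + 1, i] @ y) \<longrightarrow> R (x @ [i + 1, i, i + 1] @ y)) \<and>
     (\<forall>x y i. i > 0 \<and> R (x @ y) \<and> R (x @ [i] @ y) \<longrightarrow> R (x @ [i, i] @ y))"

lemma skein_closed_far:
  "skein_closed R \<Longrightarrow> i > 0 \<Longrightarrow> j > 0 \<Longrightarrow> \<bar>i - j\<bar> \<ge> 2 \<Longrightarrow> R (x @ [i, j] @ y) \<Longrightarrow> R (x @ [j, i] @ y)"
  unfolding skein_closed_def by blast

text \<open>The direction matters: with \<open>i + 1\<close> as top generator, the conclusion has
  two occurrences of it and the hypothesis only one, so this rule lowers the number of occurrences
  in a reduction.\<close>

lemma skein_closed_braid:
  "skein_closed R \<Longrightarrow> i > 0 \<Longrightarrow> R (x @ [i, i + 1, i] @ y) \<Longrightarrow> R (x @ [i + 1, i, i + 1] @ y)"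
  unfolding skein_closed_def by blast

lemma skein_closed_square:
  "skein_closed R \<Longrightarrow> i > 0 \<Longrightarrow> R (x @ y) \<Longrightarrow> R (x @ [i] @ y) \<Longrightarrow> R (x @ [i, i] @ y)"
  unfolding skein_closed_def by blast

text \<open>Lets the reduction be applied to a subword while the rest of the word is kept as
  context.\<close>

lemma skein_closed_context:
  assumes "skein_closed R"
  shows "skein_closed (\<lambda>u. R (x @ u @ y))"
  unfolding skein_closed_def
proof (intro conjI allI impI)
  fix s t :: braid_word and i j :: int
  assume "0 < i \<and> 0 < j \<and> 2 \<le> \<bar>i - j\<bar> \<and> R (x @ (s @ [i, j] @ t) @ y)"
  then show "R (x @ (s @ [j, i] @ t) @ y)"
    using skein_closed_far[OF assms, of i j "x @ s" "t @ y"] by simp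
next
  fix s t :: braid_word and i :: int
  assume "0 < i \<and> R (x @ (s @ [i, i + 1, i] @ t) @ y)"
  then show "R (x @ (s @ [i + 1, i, i + 1] @ t) @ y)"
    using skein_closed_braid[OF assms, of i "x @ s" "t @ y"] by simp
next
  fix s t :: braid_word and i :: int
  assume "0 < i \<and> R (x @ (s @ t) @ y) \<and> R (x @ (s @ [i] @ t) @ y)"
  then show "R (x @ (s @ [i, i] @ t) @ y)"
    using skein_closed_square[OF assms, of i "x @ s" "t @ y"] by simp
qed

lemma skein_closed_move_left:
  assumes "skein_closed R" "k > 0" "\<forall>a\<in>set u. a > 0 \<and> \<bar>a - k\<bar> \<ge> 2" "R (x @ u @ [k] @ y)"
  shows "R (x @ [k] @ u @ y)"
  using assms(3,4)
proof (induction u arbitrary: x)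
  case (Cons a u)
  have "R ((x @ [a]) @ [k] @ u @ y)"
    by (rule Cons.IH) (use Cons.prems in auto)
  then show ?case
    using skein_closed_far[OF assms(1), of a k x "u @ y"] Cons.prems assms(2) by simp
qed simp

lemma skein_closed_move_right:
  assumes "skein_closed R" "k > 0" "\<forall>a\<in>set u. a > 0 \<and> \<bar>a - k\<bar> \<ge> 2" "R (x @ [k] @ u @ y)"
  shows "R (x @ u @ [k] @ y)"
  using assms(3,4)
proof (induction u arbitrary: x)
  case (Cons a u)
  have "R ((x @ [a]) @ [k] @ u @ y)"
    using skein_closed_far[OF assms(1), of k a x "u @ y"] Cons.prems assms(2)
    by (simp add: abs_minus_commute)
  then have "R ((x @ [a]) @ u @ [k] @ y)"
    by (rule Cons.IH[rotated]) (use Cons.prems in auto)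
  then show ?case by simp
qed simp

text \<open>As in the Hecke algebra, every word reduces to words that contain the top generator at most once:
  inductively the word between two consecutive occurrences of \<open>\<sigma>\<^sub>k\<close> contains \<open>\<sigma>\<^sub>k\<^sub>-\<^sub>1\<close> at most once, so
  that the two occurrences can be merged by a square or a braid relation.\<close>

lemma skein_closed_span:
  assumes "skein_closed R"
    and "\<And>w. set w \<subseteq> {1..int k} \<Longrightarrow> count_list w (int k) \<le> 1 \<Longrightarrow> R w"
    and "set w \<subseteq> {1..int k}"
  shows "R w"
  using assms
proof (induction k arbitrary: R w)
  case 0
  then show ?case by simp
next
  case (Suc k)
  define K where "K = int (Suc k)"
  have K: "K > 0" by (simp add: K_def)
  note sc = Suc.prems(1)
  have base: "R w" if "set w \<subseteq> {1..K}" "count_list w K \<le> 1" for w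
    using Suc.prems(2) that by (simp add: K_def)
  from Suc.prems(3) have "set w \<subseteq> {1..K}" by (simp add: K_def)
  then show ?case
  proof (induction "count_list w K" arbitrary: w rule: less_induct)
    case less
    show ?case
    proof (cases "count_list w K \<le> 1")
      case True
      then show ?thesis using base less.prems by blast
    next
      case False
      then have "K \<in> set w" by (metis count_notin zero_le_one)
      then obtain x r where w: "w = x @ K # r" "K \<notin> set x" by (meson split_list_first)
      have "count_list r K \<ge> 1" using False w by simp
      then have "K \<in> set r" by (metis count_notin not_one_le_zero)
      then obtain u y where r: "r = u @ K # y" "K \<notin> set u" by (meson split_list_first)
      have wxy: "w = x @ (K # u @ [K]) @ y" using w r by simp
      have u: "set u \<subseteq> {1..int k}"
      proof
        fix a assume "a \<in> set u"
        then have "a \<in> {1..K}" "a \<noteq> K" using less.prems r(2) unfolding wxy by auto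
        then show "a \<in> {1..int k}" by (auto simp: K_def)
      qed
      have sx: "set x \<subseteq> {1..K}" and sy: "set y \<subseteq> {1..K}" using less.prems wxy by auto
      have cw: "count_list w K = count_list x K + 2 + count_list y K"
        using wxy r(2) by simp
      \<comment> \<open>The middle word \<open>u\<close> uses only generators below
        \<open>K\<close>, so the induction hypothesis for \<open>k\<close> reduces it, with the
        surrounding word, including both occurrences of \<open>K\<close>, absorbed into the
        predicate.\<close>
      define R' where "R' = (\<lambda>v. R ((x @ [K]) @ v @ ([K] @ y)))"
      have "R' u"
      proof (rule Suc.IH[OF _ _ u])
        show "skein_closed R'" unfolding R'_def by (rule skein_closed_context[OF sc])
      next
        fix v assume v: "set v \<subseteq> {1..int k}" "count_list v (int k) \<le> 1"
        have sv: "set v \<subseteq> {1..K}" "K \<notin> set v" using v by (auto simp: K_def)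
        have far: "\<forall>c\<in>set u. c > 0 \<and> \<bar>c - K\<bar> \<ge> 2"
          if "set u \<subseteq> {1..int k}" "int k \<notin> set u" for u
        proof
          fix c assume "c \<in> set u"
          then have "c \<in> {1..int k}" "c \<noteq> int k" using that by auto
          then show "c > 0 \<and> \<bar>c - K\<bar> \<ge> 2" by (auto simp: K_def)
        qed
        show "R' v"
        proof (cases "int k \<in> set v")
          case False
          then have far: "\<forall>a\<in>set v. a > 0 \<and> \<bar>a - K\<bar> \<ge> 2"
            using far v(1) by blast
          \<comment> \<open>\<open>v\<close> commutes with the generator \<open>K\<close>, so the
            two occurrences become adjacent, and the square relation trades them for none or
            one.\<close>
          have "R (x @ v @ y)" "R ((x @ v) @ [K] @ y)"
            by (rule less.hyps; use cw sx sy sv K in auto)+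
          then have "R ((x @ v) @ [K, K] @ y)"
            using skein_closed_square[OF sc K, of "x @ v" y] by simp
          then have "R (x @ v @ [K] @ ([K] @ y))" by simp
          then have "R (x @ [K] @ v @ ([K] @ y))"
            by (rule skein_closed_move_left[OF sc K far])
          then show ?thesis by (simp add: R'_def)
        next
          case True
          then obtain a b where vab: "v = a @ int k # b" by (meson split_list)
          have k: "int k > 0" using True v(1) by auto
          have "int k \<notin> set a" "int k \<notin> set b"
            using v(2) unfolding vab by (auto simp: count_list_0_iff)
          then have fa: "\<forall>c\<in>set a. c > 0 \<and> \<bar>c - K\<bar> \<ge> 2" and fb: "\<forall>c\<in>set b. c > 0 \<and> \<bar>c - K\<bar> \<ge> 2"
            using v(1) far unfolding vab by auto
          have K1: "int k + 1 = K" by (simp add: K_def)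
          \<comment> \<open>One \<open>K\<close> here against two in \<open>[K, int k, K]\<close>:
            the inner induction on the number of occurrences applies.\<close>
          have "R ((x @ a) @ [int k, K, int k] @ (b @ y))"
            by (rule less.hyps; use cw sx sy sv K k vab in \<open>auto simp: K_def\<close>)
          then have "R ((x @ a) @ [K, int k, K] @ (b @ y))"
            using skein_closed_braid[OF sc k, of "x @ a" "b @ y"] K1 by simp
          then have "R (x @ a @ [K] @ ([int k, K] @ b @ y))" by simp
          then have "R (x @ [K] @ a @ ([int k, K] @ b @ y))"
            by (rule skein_closed_move_left[OF sc K fa])
          then have "R ((x @ [K] @ a @ [int k]) @ [K] @ b @ y)" by simp
          then have "R ((x @ [K] @ a @ [int k]) @ b @ [K] @ y)"
            by (rule skein_closed_move_right[OF sc K fb])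
          then show ?thesis by (simp add: R'_def vab)
        qed
      qed
      then show ?thesis by (simp add: R'_def wxy)
    qed
  qed
qed

section \<open>Induction over closed braids\<close>

lemma valid_braid_append [simp]:
  "valid_braid n (u @ v) \<longleftrightarrow> valid_braid n u \<and> valid_braid n v"
  by (auto simp: valid_braid_def)

lemma valid_braid_Cons [simp]:
  "valid_braid n (k # w) \<longleftrightarrow> k \<noteq> 0 \<and> \<bar>k\<bar> < int n \<and> valid_braid n w"
  by (auto simp: valid_braid_def)

lemma valid_braid_Nil [simp]: "valid_braid n [] \<longleftrightarrow> n \<ge> 1"
  by (simp add: valid_braid_def)

lemma valid_braid_Suc: "valid_braid n w \<Longrightarrow> valid_braid (Suc n) w"
  by (force simp: valid_braid_def)

text \<open>For positive words \<open>skein_closed_span\<close> leaves at most one top generator: a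
  single one is conjugated to the end and removed by stabilisation, and if there is none the last
  strand splits off. Negative letters are then removed by the skein relation, by induction on their
  number.\<close>

lemma homfly_induct [consumes 1, case_names unknot equiv conj stab unlink skein skein_neg]:
  assumes "valid_braid n w"
    and unknot: "Q 1 []"
    and equiv: "\<And>n w v. valid_braid n w \<Longrightarrow> valid_braid n v \<Longrightarrow> braid_equiv w v \<Longrightarrow> Q n w \<Longrightarrow> Q n v"
    and conj: "\<And>n u v. valid_braid n (u @ v) \<Longrightarrow> Q n (u @ v) \<Longrightarrow> Q n (v @ u)"
    and stab: "\<And>n w. valid_braid n w \<Longrightarrow> Q n w \<Longrightarrow> Q (Suc n) (w @ [int n])"
    and unlink: "\<And>n w. valid_braid n w \<Longrightarrow> Q n w \<Longrightarrow> Q (Suc n) w"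
    and skein: "\<And>n w i. valid_braid n w \<Longrightarrow> 1 \<le> i \<Longrightarrow> i < int n \<Longrightarrow> Q n w \<Longrightarrow> Q n (w @ [i]) \<Longrightarrow> Q n (w @ [i, i])"
    and skein': "\<And>n w i. valid_braid n w \<Longrightarrow> 1 \<le> i \<Longrightarrow> i < int n \<Longrightarrow> Q n w \<Longrightarrow> Q n (w @ [i]) \<Longrightarrow> Q n (w @ [- i])"
  shows "Q n w"
proof -
  \<comment> \<open>Conjugation carries the skein rules, assumed only at the end of a word, to any
    position.\<close>
  have mid: "Q n (x @ g @ y)"
    if "Q n (x @ y)" "Q n (x @ [i] @ y)" "valid_braid n (x @ y)" "1 \<le> i" "i < int n" "g = [i, i] \<or> g = [- i]"
    for n x y i g
  proof -
    have v: "valid_braid n (y @ x)" "valid_braid n [i]" "valid_braid n [- i]" "valid_braid n [i, i]"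
      using that by (auto simp: valid_braid_def)
    have "Q n (y @ x)" using conj[of n x y] that by simp
    moreover have "Q n ((y @ x) @ [i])" using conj[of n "x @ [i]" y] v that by simp
    ultimately have "Q n ((y @ x) @ g)" using skein skein' v that by metis
    then show ?thesis using conj[of n y "x @ g"] v that by auto
  qed
  \<comment> \<open>Validity is part of the predicate because \<open>skein_closed\<close> ranges
    over words with arbitrary letters.\<close>
  have closed: "skein_closed (\<lambda>w. valid_braid n w \<longrightarrow> Q n w)" for n
    unfolding skein_closed_def
  proof (intro conjI allI impI)
    fix x y :: braid_word and i j :: int
    assume *: "0 < i \<and> 0 < j \<and> 2 \<le> \<bar>i - j\<bar> \<and> (valid_braid n (x @ [i, j] @ y) \<longrightarrow> Q n (x @ [i, j] @ y))"
      and v: "valid_braid n (x @ [j, i] @ y)"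
    have v': "valid_braid n (x @ [i, j] @ y)" using v by (auto simp: valid_braid_def)
    have "braid_equiv (x @ [i, j] @ y) (x @ [j, i] @ y)"
      using * by (intro braid_equiv.basic braid_basic.far) auto
    then show "Q n (x @ [j, i] @ y)" using equiv v v' * by blast
  next
    fix x y :: braid_word and i :: int
    assume *: "0 < i \<and> (valid_braid n (x @ [i, i + 1, i] @ y) \<longrightarrow> Q n (x @ [i, i + 1, i] @ y))"
      and v: "valid_braid n (x @ [i + 1, i, i + 1] @ y)"
    have v': "valid_braid n (x @ [i, i + 1, i] @ y)" using v by (auto simp: valid_braid_def)
    have "braid_equiv (x @ [i, i + 1, i] @ y) (x @ [i + 1, i, i + 1] @ y)"
      using * by (intro braid_equiv.basic braid_basic.braid) auto
    then show "Q n (x @ [i + 1, i, i + 1] @ y)" using equiv v v' * by blast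
  next
    fix x y :: braid_word and i :: int
    assume *: "0 < i \<and> (valid_braid n (x @ y) \<longrightarrow> Q n (x @ y)) \<and> (valid_braid n (x @ [i] @ y) \<longrightarrow> Q n (x @ [i] @ y))"
      and v: "valid_braid n (x @ [i, i] @ y)"
    have "valid_braid n (x @ y)" "valid_braid n (x @ [i] @ y)" "i < int n"
      using v * by (auto simp: valid_braid_def)
    then show "Q n (x @ [i, i] @ y)" using mid[of n x y i "[i, i]"] * by simp
  qed
  have positive: "Q n w" if "valid_braid n w" "\<forall>k\<in>set w. k > 0" for n w
    using that
  proof (induction n arbitrary: w)
    case 0
    then show ?case by (simp add: valid_braid_def)
  next
    case (Suc n)
    have sw: "set w \<subseteq> {1..int n}" using Suc.prems by (force simp: valid_braid_def)
    show ?case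
    proof (cases "n = 0")
      case True
      then show ?thesis using sw unknot by simp
    next
      case False
      have "valid_braid (Suc n) w \<longrightarrow> Q (Suc n) w"
      proof (rule skein_closed_span[OF closed _ sw], rule impI)
        fix v assume v: "set v \<subseteq> {1..int n}" "count_list v (int n) \<le> 1" "valid_braid (Suc n) v"
        have small: "valid_braid n u \<and> (\<forall>k\<in>set u. k > 0)" if "set u \<subseteq> {1..int n}" "int n \<notin> set u" for u
        proof -
          have "1 \<le> a \<and> a < int n" if "a \<in> set u" for a
            using that \<open>set u \<subseteq> {1..int n}\<close> \<open>int n \<notin> set u\<close> by (metis atLeastAtMost_iff order_less_le subsetD)
          then show ?thesis using False by (force simp: valid_braid_def)
        qed
        show "Q (Suc n) v"
        proof (cases "int n \<in> set v")
          case True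
          then obtain x y where xy: "v = x @ int n # y" by (meson split_list)
          have "int n \<notin> set (y @ x)"
            using v(2) unfolding xy by (auto simp: count_list_0_iff)
          then have u: "valid_braid n (y @ x) \<and> (\<forall>k\<in>set (y @ x). k > 0)"
            using v(1) xy by (intro small) auto
          then have "Q n (y @ x)" using Suc.IH by blast
          then have "Q (Suc n) ((y @ x) @ [int n])" using stab u by blast
          moreover have "valid_braid (Suc n) (y @ (x @ [int n]))"
            using v(3) xy by (auto simp: valid_braid_def)
          ultimately show ?thesis using conj[of "Suc n" y "x @ [int n]"] xy by simp
        next
          case False
          then show ?thesis using small[OF v(1)] Suc.IH unlink by blast
        qed
      qed
      then show ?thesis using Suc.prems by blast
    qed
  qed
  show ?thesis
    using assms(1)
  proof (induction "length (filter (\<lambda>k. k < 0) w)" arbitrary: w rule: less_induct)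
    case less
    show ?case
    proof (cases "\<exists>k\<in>set w. k < 0")
      case True
      then obtain k where k: "k \<in> set w" "k < 0" by blast
      then obtain x y where xy: "w = x @ k # y" by (meson split_list)
      have v: "valid_braid n (x @ y)" "valid_braid n (x @ [- k] @ y)" "1 \<le> - k" "- k < int n"
        using less.prems k(2) unfolding xy by (auto simp: valid_braid_def)
      have "Q n (x @ y)"
        by (rule less.hyps) (use v k in \<open>simp_all add: xy\<close>)
      moreover have "Q n (x @ [- k] @ y)"
        by (rule less.hyps) (use v k in \<open>simp_all add: xy\<close>)
      ultimately show ?thesis using mid[of n x y "- k" "[k]"] v unfolding xy by simp
    next
      case False
      have "0 < k" if "k \<in> set w" for k
      proof -
        have "k \<noteq> 0" using less.prems that by (simp add: valid_braid_def)
        then show ?thesis using False that by (meson linorder_neqE)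
      qed
      then show ?thesis using positive less.prems by blast
    qed
  qed
qed

section \<open>Uniqueness and the degree in z\<close>

context
  fixes P :: "nat \<Rightarrow> braid_word \<Rightarrow> laurent2"
  assumes P: "is_homfly P"
begin

lemma is_homfly_invalid: "\<not> valid_braid n w \<Longrightarrow> P n w = (\<lambda>i j. 0)"
  using P unfolding is_homfly_def by blast

lemma is_homfly_finite: "finite {(i, j). P n w i j \<noteq> 0}"
  using P is_homfly_invalid[of n w] unfolding is_homfly_def by (cases "valid_braid n w") auto

lemma is_homfly_equiv:
  "valid_braid n w \<Longrightarrow> valid_braid n v \<Longrightarrow> braid_equiv w v \<Longrightarrow> P n w = P n v"
  using P unfolding is_homfly_def by blast

lemma is_homfly_conj: "valid_braid n (u @ v) \<Longrightarrow> P n (u @ v) = P n (v @ u)"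
  using P unfolding is_homfly_def by blast

lemma is_homfly_stab: "valid_braid n w \<Longrightarrow> P (Suc n) (w @ [int n]) = P n w"
  and is_homfly_stab_neg: "valid_braid n w \<Longrightarrow> P (Suc n) (w @ [- int n]) = P n w"
  using P unfolding is_homfly_def by simp_all

lemma is_homfly_unknot: "P 1 [] = laurent_one"
  using P unfolding is_homfly_def by blast

lemma is_homfly_skein:
  assumes "valid_braid n w" "1 \<le> i" "i < int n"
  shows "P n (w @ [i, i]) k l = P n w (k - 2) l + P n (w @ [i]) (k - 1) (l - 1)"
proof -
  have "P n (w @ [i, i]) (k - 1 + 1) l - P n w (k - 1 - 1) l = P n (w @ [i]) (k - 1) (l - 1)"
    using P assms unfolding is_homfly_def by blast
  then show ?thesis by simp
qed

text \<open>This is the skein relation at \<open>w @ [- i]\<close>, after cancelling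
  \<open>- i\<close> against \<open>i\<close> in the other two terms.\<close>

lemma is_homfly_skein_neg:
  assumes "valid_braid n w" "1 \<le> i" "i < int n"
  shows "P n (w @ [- i]) k l = P n (w @ [i]) (k + 2) l - P n w (k + 1) (l - 1)"
proof -
  have v: "valid_braid n [i]" "valid_braid n [- i]" using assms by auto
  have "braid_equiv ((w @ [- i]) @ [i]) w"
    using braid_equiv.basic[OF braid_basic.cancel2[of i], of w "[]"] assms(2) by simp
  then have 1: "P n ((w @ [- i]) @ [i]) = P n w"
    by (rule is_homfly_equiv[rotated 2]) (use assms v in auto)
  have "braid_equiv ((w @ [- i]) @ [i, i]) (w @ [i])"
    using braid_equiv.basic[OF braid_basic.cancel2[of i], of w "[i]"] assms(2) by simp
  then have 2: "P n ((w @ [- i]) @ [i, i]) = P n (w @ [i])"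
    by (rule is_homfly_equiv[rotated 2]) (use assms v in auto)
  show ?thesis
    using is_homfly_skein[of n "w @ [- i]" i "k + 2" l] assms v
    unfolding 1 2 by (simp add: algebra_simps)
qed

text \<open>The positive and the negative stabilisation of \<open>w\<close> both have the polynomial
  of \<open>w\<close>, and the skein relation between them has the split closure as its smoothing.
  This gives the factor (1/a - a)/z.\<close>

lemma is_homfly_unlink:
  assumes "valid_braid n w"
  shows "P (Suc n) w k l = P n w (k + 1) (l + 1) - P n w (k - 1) (l + 1)"
proof -
  have "n \<ge> 1" using assms by (simp add: valid_braid_def)
  then show ?thesis
    using is_homfly_skein_neg[of "Suc n" w "int n" "k - 1" "l + 1"] valid_braid_Suc[OF assms]
    unfolding is_homfly_stab[OF assms] is_homfly_stab_neg[OF assms] by (simp add: algebra_simps)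
qed

end

lemma is_homfly_unique:
  assumes P: "is_homfly P" and P': "is_homfly P'"
  shows "P = P'"
proof (intro ext)
  fix n w k l
  have "P n w = P' n w"
  proof (cases "valid_braid n w")
    case True
    then show ?thesis
    proof (induction rule: homfly_induct)
      case unknot
      show ?case unfolding is_homfly_unknot[OF P] is_homfly_unknot[OF P'] ..
    next
      case (equiv n w v)
      then show ?case
        unfolding is_homfly_equiv[OF P equiv(1-3)] is_homfly_equiv[OF P' equiv(1-3)] by blast
    next
      case (conj n u v)
      then show ?case
        unfolding is_homfly_conj[OF P conj(1)] is_homfly_conj[OF P' conj(1)] by blast
    next
      case (stab n w)
      then show ?case
        unfolding is_homfly_stab[OF P stab(1)] is_homfly_stab[OF P' stab(1)] by blast
    next
      case (unlink n w)
      then show ?case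
        by (intro ext) (simp only: is_homfly_unlink[OF P unlink(1)] is_homfly_unlink[OF P' unlink(1)])
    next
      case (skein n w i)
      then show ?case
        by (intro ext) (simp only: is_homfly_skein[OF P skein(1-3)] is_homfly_skein[OF P' skein(1-3)])
    next
      case (skein_neg n w i)
      then show ?case
        by (intro ext) (simp only: is_homfly_skein_neg[OF P skein_neg(1-3)] is_homfly_skein_neg[OF P' skein_neg(1-3)])
    qed
  next
    case False
    then show ?thesis using is_homfly_invalid[OF P] is_homfly_invalid[OF P'] by simp
  qed
  then show "P n w k l = P' n w k l" by simp
qed

text \<open>The number of these sets is 2 to the number of components of the closure, which makes it a
  convenient substitute for counting cycles.\<close>

definition invariant_sets :: "nat \<Rightarrow> (nat \<Rightarrow> nat) \<Rightarrow> nat set set" where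
  "invariant_sets n f = {A. A \<subseteq> {..<n} \<and> (\<forall>x<n. f x \<in> A \<longleftrightarrow> x \<in> A)}"

lemma finite_invariant_sets [simp]: "finite (invariant_sets n f)"
  by (rule finite_subset[of _ "Pow {..<n}"]) (auto simp: invariant_sets_def)

section \<open>Permutations of braids and the number of components\<close>

lemma braid_perm_Nil [simp]: "braid_perm [] = id"
  and braid_perm_Cons: "braid_perm (k # w) = letter_perm k \<circ> braid_perm w"
  by (simp_all add: braid_perm_def)

lemma braid_perm_append: "braid_perm (u @ v) = braid_perm u \<circ> braid_perm v"
  by (induction u) (simp_all add: braid_perm_Cons comp_assoc)

lemma braid_perm_single [simp]: "braid_perm [k] = letter_perm k"
  by (simp add: braid_perm_Cons)

lemma letter_perm_uminus [simp]: "letter_perm (- k) = letter_perm k"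
  unfolding letter_perm_def abs_minus_cancel ..

lemma letter_perm_less:
  assumes "k \<noteq> 0" "\<bar>k\<bar> < int n"
  shows "letter_perm k x < n \<longleftrightarrow> x < n"
proof -
  have "nat \<bar>k\<bar> < n" "nat \<bar>k\<bar> - 1 < n" using assms by linarith+
  then show ?thesis by (auto simp: letter_perm_def)
qed

lemma letter_perm_fixes:
  assumes "k \<noteq> 0" "\<bar>k\<bar> < int n" "x \<ge> n"
  shows "letter_perm k x = x"
proof -
  have "nat \<bar>k\<bar> < n" "nat \<bar>k\<bar> - 1 < n" using assms by linarith+
  then show ?thesis using assms(3) by (auto simp: letter_perm_def)
qed

lemma letter_perm_involution [simp]: "letter_perm k (letter_perm k x) = x"
  by (auto simp: letter_perm_def)

lemma letter_perm_comp_self [simp]: "letter_perm k \<circ> letter_perm k = id"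
  by (simp add: fun_eq_iff)

lemma letter_perm_of_nat:
  "letter_perm (int (Suc a)) x = (if x = a then Suc a else if x = Suc a then a else x)"
  by (simp add: letter_perm_def nat_add_distrib del: of_nat_Suc)

lemma letter_perm_far:
  assumes "i > 0" "j > 0" "\<bar>i - j\<bar> \<ge> 2"
  shows "letter_perm i (letter_perm j x) = letter_perm j (letter_perm i x)"
proof -
  obtain a b where ab: "i = int (Suc a)" "j = int (Suc b)"
    using assms by (metis gr0_implies_Suc zero_less_imp_eq_int)
  have "a \<noteq> b" "Suc a \<noteq> b" "a \<noteq> Suc b" using assms(3) unfolding ab by auto
  then show ?thesis unfolding ab letter_perm_of_nat by simp
qed

lemma letter_perm_braid:
  assumes "i > 0"
  shows "letter_perm i (letter_perm (i + 1) (letter_perm i x))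
    = letter_perm (i + 1) (letter_perm i (letter_perm (i + 1) x))"
proof -
  obtain a where i: "i = int (Suc a)" using assms by (metis gr0_implies_Suc zero_less_imp_eq_int)
  have i1: "i + 1 = int (Suc (Suc a))" using i by simp
  consider "x = a" | "x = Suc a" | "x = Suc (Suc a)" | "x \<noteq> a" "x \<noteq> Suc a" "x \<noteq> Suc (Suc a)" by blast
  then show ?thesis unfolding i1 unfolding i letter_perm_of_nat by cases simp_all
qed

lemma braid_perm_equiv: "braid_equiv w v \<Longrightarrow> braid_perm w = braid_perm v"
proof (induction rule: braid_equiv.induct)
  case (basic x y u v)
  then have "braid_perm x = braid_perm y"
    by cases (simp_all add: braid_perm_Cons fun_eq_iff letter_perm_far letter_perm_braid)
  then show ?case by (simp add: braid_perm_append)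
qed auto

lemma braid_perm_fixes:
  assumes "valid_braid n w" "x \<ge> n"
  shows "braid_perm w x = x"
  using assms by (induction w) (auto simp: braid_perm_Cons letter_perm_fixes)

lemma braid_perm_less:
  assumes "valid_braid n w" "x < n"
  shows "braid_perm w x < n"
  using assms by (induction w) (auto simp: braid_perm_Cons letter_perm_less)

lemma braid_perm_image:
  assumes "valid_braid n w"
  shows "braid_perm w ` {..<n} = {..<n}"
proof (rule endo_inj_surj)
  show "inj_on (braid_perm w) {..<n}"
  proof (induction w)
    case (Cons k w)
    have "inj (letter_perm k)" by (rule inj_on_inverseI[where g = "letter_perm k"]) simp
    then have "inj_on (letter_perm k) (braid_perm w ` {..<n})" by (rule inj_on_subset) simp
    with Cons show ?case unfolding braid_perm_Cons by (rule comp_inj_on)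
  qed simp
qed (use assms braid_perm_less in auto)

text \<open>The two permutations are conjugate by \<open>braid_perm u\<close>, and preimages under
  it carry invariant sets to invariant sets.\<close>

lemma card_invariant_sets_conj:
  assumes "valid_braid n (u @ v)"
  shows "card (invariant_sets n (braid_perm (u @ v))) \<le> card (invariant_sets n (braid_perm (v @ u)))"
proof (rule card_inj_on_le)
  define f where "f A = {x. x < n \<and> braid_perm u x \<in> A}" for A
  have vu: "valid_braid n u" and vv: "valid_braid n v" using assms by auto
  show "inj_on f (invariant_sets n (braid_perm (u @ v)))"
  proof (rule inj_on_inverseI)
    fix A assume "A \<in> invariant_sets n (braid_perm (u @ v))"
    then have "A \<subseteq> braid_perm u ` {..<n}"
      using braid_perm_image[OF vu] by (auto simp: invariant_sets_def)
    then show "braid_perm u ` f A = A" by (auto simp: f_def)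
  qed
  show "f ` invariant_sets n (braid_perm (u @ v)) \<subseteq> invariant_sets n (braid_perm (v @ u))"
    using braid_perm_less[OF vu] braid_perm_less[OF vv]
    by (auto simp: f_def invariant_sets_def braid_perm_append)
qed simp

text \<open>A transposition merges two cycles or splits one, so the number of components grows by at
  most one.\<close>

lemma card_invariant_sets_crossing:
  assumes "1 \<le> i" "i < int n"
  shows "card (invariant_sets n (f \<circ> letter_perm i)) \<le> 2 * card (invariant_sets n f)"
proof -
  define a where "a = nat i - 1"
  define b where "b = nat i"
  have ab: "a < n" "b < n" using assms by (auto simp: a_def b_def)
  have s: "letter_perm i x = (if x = a then b else if x = b then a else x)" for x
    using assms by (simp add: letter_perm_def a_def b_def)
  define G where "G = invariant_sets n (f \<circ> letter_perm i)"
  define H where "H = {A \<in> G. a \<in> A \<longleftrightarrow> b \<in> A}"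
  have fin: "finite G" "finite H" by (simp_all add: G_def H_def)
  have "H \<subseteq> invariant_sets n f"
  proof
    fix A assume A: "A \<in> H"
    have "f x \<in> A \<longleftrightarrow> x \<in> A" if "x < n" for x
    proof -
      have "letter_perm i x < n" using that ab by (auto simp: s)
      moreover have "\<forall>y<n. f (letter_perm i y) \<in> A \<longleftrightarrow> y \<in> A"
        using A by (simp add: H_def G_def invariant_sets_def)
      ultimately have "f (letter_perm i (letter_perm i x)) \<in> A \<longleftrightarrow> letter_perm i x \<in> A"
        by blast
      moreover have "letter_perm i x \<in> A \<longleftrightarrow> x \<in> A"
        using A by (auto simp: H_def s)
      ultimately show ?thesis by simp
    qed
    then show "A \<in> invariant_sets n f" using A by (auto simp: H_def G_def invariant_sets_def)
  qed
  then have H: "card H \<le> card (invariant_sets n f)" by (simp add: card_mono)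
  \<comment> \<open>Under symmetric difference \<open>G\<close> is a group and \<open>H\<close>, the
    sets that do not separate the two strands, a subgroup of index at most 2; translation by a fixed
    \<open>B\<close> maps the other coset into \<open>H\<close>.\<close>
  have "card (G - H) \<le> card H"
  proof (cases "G - H = {}")
    case False
    then obtain B where B: "B \<in> G - H" by blast
    show ?thesis
    proof (rule card_inj_on_le)
      show "inj_on (\<lambda>A. sym_diff A B) (G - H)"
        by (rule inj_on_inverseI[where g = "\<lambda>A. sym_diff A B"]) auto
      show "(\<lambda>A. sym_diff A B) ` (G - H) \<subseteq> H"
        using B by (auto simp: H_def G_def invariant_sets_def)
    qed (use fin in simp)
  next
    case True
    then show ?thesis by (simp only: card.empty zero_le)
  qed
  moreover have "card G = card (G - H) + card H"
    using fin card_Diff_subset[of H G] card_mono[of G H] by (auto simp: H_def)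
  ultimately show ?thesis using H unfolding G_def by linarith
qed

text \<open>The new strand joins the cycle of \<open>n - 1\<close>, so an invariant set has to gain
  \<open>n\<close> exactly when it contains \<open>n - 1\<close>.\<close>

lemma card_invariant_sets_stab:
  assumes "valid_braid n w"
  shows "card (invariant_sets n (braid_perm w)) \<le> card (invariant_sets (Suc n) (braid_perm (w @ [int n])))"
proof (rule card_inj_on_le)
  define f where "f A = (if n - 1 \<in> A then insert n A else A)" for A :: "nat set"
  have n: "n \<ge> 1" using assms by (simp add: valid_braid_def)
  show "inj_on f (invariant_sets n (braid_perm w))"
    by (rule inj_on_inverseI[where g = "\<lambda>A. A - {n}"]) (auto simp: f_def invariant_sets_def)
  have s: "letter_perm (int n) x = (if x = n - 1 then n else if x = n then n - 1 else x)" for x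
    by (simp add: letter_perm_def)
  have fn: "braid_perm w n = n" using braid_perm_fixes[OF assms] by simp
  show "f ` invariant_sets n (braid_perm w) \<subseteq> invariant_sets (Suc n) (braid_perm (w @ [int n]))"
  proof safe
    fix A assume A: "A \<in> invariant_sets n (braid_perm w)"
    have sub: "f A \<subseteq> {..<Suc n}" using A by (auto simp: f_def invariant_sets_def)
    have nA: "n \<notin> A" using A by (auto simp: invariant_sets_def)
    have fA: "y \<in> f A \<longleftrightarrow> y \<in> A" if "y < n" for y using that by (auto simp: f_def)
    have fAn: "n \<in> f A \<longleftrightarrow> n - 1 \<in> A" using nA by (auto simp: f_def)
    have inv: "braid_perm w y \<in> f A \<longleftrightarrow> y \<in> A" if "y < n" for y
      using that A fA[OF braid_perm_less[OF assms that]] by (auto simp: invariant_sets_def)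
    have "braid_perm w (letter_perm (int n) x) \<in> f A \<longleftrightarrow> x \<in> f A" if "x < Suc n" for x
    proof -
      have "x = n - 1 \<or> x = n \<or> x < n - 1" using that by arith
      then consider "x = n - 1" | "x = n" | "x < n - 1" by blast
      then show ?thesis
      proof cases
        case 1
        then show ?thesis using n fn fAn fA[of "n - 1"] by (simp add: s)
      next
        case 2
        then show ?thesis using n fAn inv[of "n - 1"] by (auto simp: s)
      next
        case 3
        then show ?thesis using fA[of x] inv[of x] by (auto simp: s)
      qed
    qed
    then show "f A \<in> invariant_sets (Suc n) (braid_perm (w @ [int n]))"
      using sub by (simp add: invariant_sets_def braid_perm_append)
  qed
qed simp

text \<open>The new strand is a fixed point, which may be added to any invariant set or left
  out.\<close>

lemma card_invariant_sets_unlink: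
  assumes "valid_braid n w"
  shows "2 * card (invariant_sets n (braid_perm w)) \<le> card (invariant_sets (Suc n) (braid_perm w))"
proof -
  let ?I = "invariant_sets n (braid_perm w)"
  have fn: "braid_perm w n = n" using braid_perm_fixes[OF assms] by simp
  have notin: "n \<notin> A" if "A \<in> ?I" for A using that by (auto simp: invariant_sets_def)
  have "inj_on (insert n) ?I"
    by (rule inj_on_inverseI[where g = "\<lambda>A. A - {n}"]) (use notin in auto)
  then have "card (insert n ` ?I) = card ?I" by (rule card_image)
  moreover have "?I \<inter> insert n ` ?I = {}" using notin by auto
  ultimately have "card (?I \<union> insert n ` ?I) = 2 * card ?I"
    by (subst card_Un_disjoint) auto
  moreover have "card (?I \<union> insert n ` ?I) \<le> card (invariant_sets (Suc n) (braid_perm w))"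
    using fn braid_perm_less[OF assms]
    by (intro card_mono) (auto simp: invariant_sets_def less_Suc_eq)
  ultimately show ?thesis by linarith
qed

text \<open>Here \<open>c\<close> bounds the number of components. Smoothing a crossing changes that
  number by at most one, which the factor z of the skein relation offsets; a split strand costs one
  power of z and brings one component. Quantifying over \<open>c\<close> in the induction means that
  only inequalities between the cardinalities are used.\<close>

lemma is_homfly_z_degree:
  assumes P: "is_homfly P" and "valid_braid n w"
    and "card (invariant_sets n (braid_perm w)) \<le> 2 ^ c" "P n w k l \<noteq> 0"
  shows "1 - int c \<le> l"
proof -
  have "\<forall>c k l. card (invariant_sets n (braid_perm w)) \<le> 2 ^ c \<longrightarrow> P n w k l \<noteq> 0 \<longrightarrow> 1 - int c \<le> l"
    using assms(2)
  proof (induction rule: homfly_induct)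
    case unknot
    have "card {{}, {0::nat}} \<le> card (invariant_sets 1 (braid_perm []))"
      by (intro card_mono) (auto simp: invariant_sets_def)
    moreover have "\<not> 2 \<le> (2::nat) ^ 0" by simp
    ultimately have c: "1 \<le> c" if "card (invariant_sets 1 (braid_perm [])) \<le> 2 ^ c" for c
      using that by (cases c) simp_all
    show ?case
    proof (intro allI impI)
      fix c and k l :: int
      assume "card (invariant_sets 1 (braid_perm [])) \<le> 2 ^ c" and nz: "P 1 [] k l \<noteq> 0"
      then have "1 \<le> c" using c by blast
      moreover have "l = 0" using nz unfolding is_homfly_unknot[OF P] laurent_one_def by metis
      ultimately show "1 - int c \<le> l" by simp
    qed
  next
    case (equiv n w v)
    then show ?case
      unfolding is_homfly_equiv[OF P equiv(1-3)] braid_perm_equiv[OF equiv(3)] by blast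
  next
    case (conj n u v)
    then show ?case
      unfolding is_homfly_conj[OF P conj(1)] using card_invariant_sets_conj[OF conj(1)] le_trans by blast
  next
    case (stab n w)
    then show ?case
      unfolding is_homfly_stab[OF P stab(1)] using card_invariant_sets_stab[OF stab(1)] le_trans by blast
  next
    case (unlink n w)
    show ?case
    proof (intro allI impI)
      fix c k l
      assume c: "card (invariant_sets (Suc n) (braid_perm w)) \<le> 2 ^ c" and nz: "P (Suc n) w k l \<noteq> 0"
      have le: "2 * card (invariant_sets n (braid_perm w)) \<le> 2 ^ c"
        using card_invariant_sets_unlink[OF unlink(1)] c by linarith
      \<comment> \<open>Some invariant set always exists, so \<open>le\<close> excludes
        \<open>c = 0\<close> and the exponent can be lowered by one.\<close>
      have "{} \<in> invariant_sets n (braid_perm w)" by (simp add: invariant_sets_def)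
      then have "card (invariant_sets n (braid_perm w)) > 0" by (auto simp: card_gt_0_iff)
      with le have "c \<noteq> 0" by (intro notI) simp
      then obtain d where d: "c = Suc d" by (cases c) auto
      have "P n w (k + 1) (l + 1) \<noteq> 0 \<or> P n w (k - 1) (l + 1) \<noteq> 0"
        using nz is_homfly_unlink[OF P unlink(1), of k l] by auto
      moreover have "card (invariant_sets n (braid_perm w)) \<le> 2 ^ d" using le d by simp
      ultimately have "1 - int d \<le> l + 1" using unlink(2) by blast
      then show "1 - int c \<le> l" using d by simp
    qed
  next
    case (skein n w i)
    have perm: "braid_perm (w @ [i, i]) = braid_perm w"
      by (simp add: braid_perm_append braid_perm_Cons)
    have le: "card (invariant_sets n (braid_perm (w @ [i]))) \<le> 2 * card (invariant_sets n (braid_perm w))"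
      using card_invariant_sets_crossing[OF skein(2,3)] by (simp add: braid_perm_append)
    show ?case
    proof (intro allI impI)
      fix c k l
      assume c: "card (invariant_sets n (braid_perm (w @ [i, i]))) \<le> 2 ^ c" and nz: "P n (w @ [i, i]) k l \<noteq> 0"
      then have "P n w (k - 2) l \<noteq> 0 \<or> P n (w @ [i]) (k - 1) (l - 1) \<noteq> 0"
        using is_homfly_skein[OF P skein(1-3), of k l] by auto
      then show "1 - int c \<le> l"
      proof
        assume "P n w (k - 2) l \<noteq> 0"
        then show ?thesis using skein(4) c perm by auto
      next
        assume "P n (w @ [i]) (k - 1) (l - 1) \<noteq> 0"
        moreover have "card (invariant_sets n (braid_perm (w @ [i]))) \<le> 2 ^ Suc c"
          using le c perm by simp
        ultimately have "1 - int (Suc c) \<le> l - 1" using skein(5) by blast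
        then show ?thesis by simp
      qed
    qed
  next
    case (skein_neg n w i)
    have perm: "braid_perm (w @ [- i]) = braid_perm (w @ [i])"
      by (simp add: braid_perm_append)
    have le: "card (invariant_sets n (braid_perm w)) \<le> 2 * card (invariant_sets n (braid_perm (w @ [i])))"
      using card_invariant_sets_crossing[OF skein_neg(2,3), of "braid_perm w \<circ> letter_perm i"]
      by (simp add: braid_perm_append comp_assoc)
    show ?case
    proof (intro allI impI)
      fix c k l
      assume c: "card (invariant_sets n (braid_perm (w @ [- i]))) \<le> 2 ^ c" and nz: "P n (w @ [- i]) k l \<noteq> 0"
      then have "P n (w @ [i]) (k + 2) l \<noteq> 0 \<or> P n w (k + 1) (l - 1) \<noteq> 0"
        using is_homfly_skein_neg[OF P skein_neg(1-3), of k l] by auto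
      then show "1 - int c \<le> l"
      proof
        assume "P n (w @ [i]) (k + 2) l \<noteq> 0"
        then show ?thesis using skein_neg(5) c perm by auto
      next
        assume "P n w (k + 1) (l - 1) \<noteq> 0"
        moreover have "card (invariant_sets n (braid_perm w)) \<le> 2 ^ Suc c"
          using le c perm by simp
        ultimately have "1 - int (Suc c) \<le> l - 1" using skein_neg(4) by blast
        then show ?thesis by simp
      qed
    qed
  qed
  then show ?thesis using assms by blast
qed

text \<open>A single cycle leaves only the empty and the full invariant set, which is the case
  \<open>c = 1\<close> of the degree bound.\<close>

lemma is_homfly_knot_z_nonneg:
  assumes "is_homfly P" "is_knot_braid n w" "P n w k l \<noteq> 0"
  shows "l \<ge> 0"
proof -
  have v: "valid_braid n w" using assms(2) by (simp add: is_knot_braid_def)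
  have "invariant_sets n (braid_perm w) \<subseteq> {{}, {..<n}}"
  proof
    fix A assume A: "A \<in> invariant_sets n (braid_perm w)"
    have "0 < n" using v by (simp add: valid_braid_def)
    then have lt: "(braid_perm w ^^ m) 0 < n" for m
      by (induction m) (auto simp: braid_perm_less[OF v])
    have "(braid_perm w ^^ m) 0 \<in> A \<longleftrightarrow> 0 \<in> A" for m
      using A lt by (induction m) (auto simp: invariant_sets_def)
    then have "j \<in> A \<longleftrightarrow> 0 \<in> A" if "j < n" for j
      using assms(2) that unfolding is_knot_braid_def by metis
    moreover have "A \<subseteq> {..<n}" using A by (simp add: invariant_sets_def)
    ultimately have "A = {} \<or> A = {..<n}" by (cases "0 \<in> A") blast+
    then show "A \<in> {{}, {..<n}}" by simp
  qed
  then have "card (invariant_sets n (braid_perm w)) \<le> card {{}, {..<n}}"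
    by (intro card_mono) auto
  also have "\<dots> \<le> 2 ^ 1" by (simp add: card_insert_if)
  finally show ?thesis using is_homfly_z_degree[OF assms(1) v, of 1 k l] assms(3) by simp
qed

section \<open>The state sum of the R-matrix\<close>

definition swap_adj :: "nat \<Rightarrow> (nat \<Rightarrow> nat) \<Rightarrow> nat \<Rightarrow> nat" where
  "swap_adj j s = s(j := s (Suc j), Suc j := s j)"

definition site :: "int \<Rightarrow> nat" where
  "site k = nat \<bar>k\<bar> - 1"

definition states :: "nat \<Rightarrow> nat \<Rightarrow> (nat \<Rightarrow> nat) set" where
  "states m n = {..<n} \<rightarrow>\<^sub>E {..<m}"

text \<open>\<open>q_neq_1\<close> makes z invertible, and \<open>m_pos\<close> makes the value of a
  closed loop positive; both occur as divisors.\<close>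

locale r_matrix =
  fixes q :: real and m :: nat
  assumes q_pos: "q > 0" and q_neq_1: "q \<noteq> 1" and m_pos: "m > 0"
begin

definition z :: real where "z = q - 1 / q"

lemma q_square: "q * q = 1 + z * q"
  using q_pos by (simp add: z_def field_simps)

lemma z_nonzero: "z \<noteq> 0"
proof
  assume "z = 0"
  then have "q * q = 1 * 1" using q_square by simp
  then show False using q_pos q_neq_1 by (auto simp: square_eq_1_iff)
qed

text \<open>The quadratic relation R^2 = 1 + z R gives R^(-1) = R - z, so a negative letter differs
  from a positive one only by subtracting z on the diagonal.\<close>

definition diag :: "int \<Rightarrow> nat \<Rightarrow> nat \<Rightarrow> real" where
  "diag k x y = (if x = y then q else if x > y then z else 0) - (if k < 0 then z else 0)"

text \<open>\<open>op k\<close> is the standard \<open>gl(m)\<close> R-matrix acting on tensors, written as functions of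
  the state \<open>s\<close> that assigns an index to each strand. Strands are numbered from 0, so
  \<open>\<sigma>\<^sub>k\<close> acts on the strands \<open>k - 1\<close> and \<open>k\<close>. Letting states be defined on all of \<open>nat\<close> lets the
  braid group on infinitely many strands act, since \<^const>\<open>braid_equiv\<close> does not bound the
  letters of intermediate words.\<close>

definition op :: "int \<Rightarrow> ((nat \<Rightarrow> nat) \<Rightarrow> real) \<Rightarrow> (nat \<Rightarrow> nat) \<Rightarrow> real" where
  "op k \<phi> s = diag k (s (site k)) (s (Suc (site k))) * \<phi> s
     + (if s (site k) = s (Suc (site k)) then 0 else \<phi> (swap_adj (site k) s))"

definition act :: "braid_word \<Rightarrow> ((nat \<Rightarrow> nat) \<Rightarrow> real) \<Rightarrow> (nat \<Rightarrow> nat) \<Rightarrow> real" where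
  "act w = foldr op w"

lemma act_Nil [simp]: "act [] \<phi> = \<phi>"
  and act_Cons: "act (k # w) \<phi> = op k (act w \<phi>)"
  and act_append: "act (u @ v) \<phi> = act u (act v \<phi>)"
  by (simp_all add: act_def)

lemma op_at_pair:
  assumes "0 < k"
  shows "op k \<phi> s = diag 1 (s (nat k - 1)) (s (nat k)) * \<phi> s
    + (if s (nat k - 1) = s (nat k) then 0 else \<phi> (s(nat k - 1 := s (nat k), nat k := s (nat k - 1))))"
  using assms by (simp add: op_def site_def diag_def swap_adj_def)

lemma op_add: "op k (\<lambda>s. \<phi> s + \<psi> s) = (\<lambda>s. op k \<phi> s + op k \<psi> s)"
  by (auto simp: op_def algebra_simps)

lemma op_scale: "op k (\<lambda>s. c * \<phi> s) = (\<lambda>s. c * op k \<phi> s)"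
  by (auto simp: op_def algebra_simps)

lemma act_add: "act w (\<lambda>s. \<phi> s + \<psi> s) = (\<lambda>s. act w \<phi> s + act w \<psi> s)"
  by (induction w arbitrary: \<phi> \<psi>) (simp_all add: act_Cons op_add)

lemma act_scale: "act w (\<lambda>s. c * \<phi> s) = (\<lambda>s. c * act w \<phi> s)"
  by (induction w arbitrary: \<phi>) (simp_all add: act_Cons op_scale)

lemma act_diff: "act w (\<lambda>s. \<phi> s - \<psi> s) = (\<lambda>s. act w \<phi> s - act w \<psi> s)"
  using act_add[of w \<phi> "\<lambda>s. - 1 * \<psi> s"] unfolding act_scale by simp

text \<open>On equal indices R is the scalar q, a root of x^2 = 1 + z x. On two distinct indices it
  is the matrix with rows (0, 1) and (1, z), which satisfies the same equation.\<close>

lemma op_square: "k > 0 \<Longrightarrow> op k (op k \<phi>) = (\<lambda>s. \<phi> s + z * op k \<phi> s)"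
proof
  fix s assume k: "k > 0"
  have qq: "q * (q * c) = c + z * (q * c)" for c
    using q_square by (metis (no_types, opaque_lifting) distrib_right mult.assoc mult_1)
  show "op k (op k \<phi>) s = \<phi> s + z * op k \<phi> s"
    using k by (auto simp: op_at_pair diag_def qq algebra_simps fun_upd_twist[of "nat k" "nat k - 1"])
qed

lemma op_neg: "k > 0 \<Longrightarrow> op (- k) \<phi> = (\<lambda>s. op k \<phi> s - z * \<phi> s)"
  by (auto simp: op_def site_def diag_def algebra_simps)

lemma op_cancel: "k > 0 \<Longrightarrow> op k (op (- k) \<phi>) = \<phi>" "k > 0 \<Longrightarrow> op (- k) (op k \<phi>) = \<phi>"
proof -
  assume k: "k > 0"
  have "op k (\<lambda>s. op k \<phi> s + (- z) * \<phi> s) = \<phi>"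
    unfolding op_add op_scale op_square[OF k] by auto
  then show "op k (op (- k) \<phi>) = \<phi>" by (simp add: op_neg[OF k])
  show "op (- k) (op k \<phi>) = \<phi>" by (simp add: op_neg[OF k] op_square[OF k])
qed

lemma op_far:
  assumes "i > 0" "j > 0" "\<bar>i - j\<bar> \<ge> 2"
  shows "op i (op j \<phi>) = op j (op i \<phi>)"
proof -
  define a b where "a = nat i - 1" and "b = nat j - 1"
  have ij: "nat i = Suc a" "nat j = Suc b" using assms by (auto simp: a_def b_def)
  have d: "a \<noteq> b" "Suc a \<noteq> b" "a \<noteq> Suc b" using assms by (auto simp: a_def b_def)
  have sw: "s(b := s (Suc b), Suc b := s b, a := s (Suc a), Suc a := s a)
     = s(a := s (Suc a), Suc a := s a, b := s (Suc b), Suc b := s b)" for s :: "nat \<Rightarrow> nat"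
    using d by (auto simp: fun_eq_iff)
  show ?thesis
    using assms d by (auto simp: fun_eq_iff op_at_pair ij sw algebra_simps)
qed

text \<open>Naming the three indices involved keeps every state in one normal form, so that the
  braid relation becomes a finite computation.\<close>

lemma op_three:
  fixes x y w :: nat
  assumes "i > 0" "s = t(nat i - 1 := x, nat i := y, Suc (nat i) := w)"
  shows "op i \<phi> s = diag 1 x y * \<phi> s
      + (if x = y then 0 else \<phi> (t(nat i - 1 := y, nat i := x, Suc (nat i) := w)))"
    and "op (i + 1) \<phi> s = diag 1 y w * \<phi> s
      + (if y = w then 0 else \<phi> (t(nat i - 1 := x, nat i := w, Suc (nat i) := y)))"
proof -
  have n: "nat (i + 1) = Suc (nat i)" "nat i - 1 \<noteq> nat i" using assms by auto
  have 1: "s(nat i - 1 := y, nat i := x) = t(nat i - 1 := y, nat i := x, Suc (nat i) := w)"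
    using assms n by (auto simp: fun_eq_iff)
  have 2: "s(nat i := w, Suc (nat i) := y) = t(nat i - 1 := x, nat i := w, Suc (nat i) := y)"
    using assms n by (auto simp: fun_eq_iff)
  have v: "s (nat i - 1) = x" "s (nat i) = y" "s (Suc (nat i)) = w" using assms n by auto
  show "op i \<phi> s = diag 1 x y * \<phi> s
      + (if x = y then 0 else \<phi> (t(nat i - 1 := y, nat i := x, Suc (nat i) := w)))"
    using op_at_pair[OF assms(1), of \<phi> s] unfolding v 1 .
  show "op (i + 1) \<phi> s = diag 1 y w * \<phi> s
      + (if y = w then 0 else \<phi> (t(nat i - 1 := x, nat i := w, Suc (nat i) := y)))"
    using op_at_pair[of "i + 1" \<phi> s] assms(1) n unfolding v by (simp add: v 2)
qed

text \<open>\<open>diag\<close> sees only the relative order of two indices, so the 13 weak orders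
  of three indices cover all states.\<close>

lemma op_braid:
  assumes "i > 0"
  shows "op i (op (i + 1) (op i \<phi>)) = op (i + 1) (op i (op (i + 1) \<phi>))"
proof
  fix s :: "nat \<Rightarrow> nat"
  define x y w where "x = s (nat i - 1)" and "y = s (nat i)" and "w = s (Suc (nat i))"
  define k where "k = i + 1"
  define f where "f x y w = s(nat i - 1 := x, nat i := y, Suc (nat i) := w)" for x y w
  have s: "s = f x y w" by (simp add: f_def x_def y_def w_def)
  have o1: "op i \<phi> (f x y w) = diag 1 x y * \<phi> (f x y w) + (if x = y then 0 else \<phi> (f y x w))"
    and o2: "op k \<phi> (f x y w) = diag 1 y w * \<phi> (f x y w) + (if y = w then 0 else \<phi> (f x w y))"
    for \<phi> x y w
    using op_three[OF assms, of "f x y w" s x y w \<phi>] by (simp_all add: f_def k_def)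
  have q2: "q * (q * c) = c + z * (q * c)" for c
    using q_square by (metis (no_types, opaque_lifting) distrib_right mult.assoc mult_1)
  consider "x = y" "y = w" | "x = y" "y < w" | "x = y" "y > w" | "x < y" "y = w" | "x > y" "y = w"
    | "x = w" "x < y" | "x = w" "x > y"
    | "x < y" "y < w" | "x < w" "w < y" | "y < x" "x < w" | "y < w" "w < x" | "w < x" "x < y" | "w < y" "y < x"
    by (metis nat_neq_iff)
  then show "op i (op (i + 1) (op i \<phi>)) s = op (i + 1) (op i (op (i + 1) \<phi>)) s"
    unfolding s k_def[symmetric] by cases (simp_all add: o1 o2 diag_def q2 algebra_simps)
qed

lemma act_equiv: "braid_equiv w v \<Longrightarrow> act w \<phi> = act v \<phi>"
proof (induction arbitrary: \<phi> rule: braid_equiv.induct)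
  case (basic x y u v)
  then have "act x \<psi> = act y \<psi>" for \<psi>
    by cases (simp_all add: act_Cons op_cancel op_far op_braid)
  then show ?case by (simp add: act_append)
qed auto

end

section \<open>The quantum trace and its Markov properties\<close>

lemma swap_adj_involution [simp]: "swap_adj j (swap_adj j s) = s"
  by (auto simp: swap_adj_def)

lemma swap_adj_states:
  assumes "Suc j < n" "s \<in> states m n"
  shows "swap_adj j s \<in> states m n"
proof -
  have "s j \<in> {..<m}" "s (Suc j) \<in> {..<m}"
    using assms PiE_mem[of s "{..<n}" "\<lambda>_. {..<m}"] by (auto simp: states_def)
  then show ?thesis
    using assms by (auto simp: swap_adj_def states_def PiE_iff extensional_def)
qed

lemma sum_states_Suc:
  fixes f :: "(nat \<Rightarrow> nat) \<Rightarrow> real"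
  shows "(\<Sum>s\<in>states m (Suc n). f s) = (\<Sum>t\<in>states m n. \<Sum>y<m. f (t(n := y)))"
proof -
  have "states m (Suc n) = (\<lambda>(y, t). t(n := y)) ` ({..<m} \<times> states m n)"
    unfolding states_def lessThan_Suc by (rule PiE_insert_eq)
  moreover have "inj_on (\<lambda>(y, t). t(n := y)) ({..<m} \<times> states m n)"
    unfolding states_def using inj_combinator[of n "{..<n}" "\<lambda>_. {..<m}"] by simp
  ultimately have "(\<Sum>s\<in>states m (Suc n). f s) = (\<Sum>(y, t)\<in>{..<m} \<times> states m n. f (t(n := y)))"
    by (simp add: sum.reindex case_prod_unfold)
  also have "\<dots> = (\<Sum>y<m. \<Sum>t\<in>states m n. f (t(n := y)))"
    by (rule sum.cartesian_product[symmetric])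
  also have "\<dots> = (\<Sum>t\<in>states m n. \<Sum>y<m. f (t(n := y)))"
    by (rule sum.swap)
  finally show ?thesis .
qed

definition delta :: "(nat \<Rightarrow> nat) \<Rightarrow> (nat \<Rightarrow> nat) \<Rightarrow> real" where
  "delta s t = (if t = s then 1 else 0)"

definition exponent_sum :: "braid_word \<Rightarrow> int" where
  "exponent_sum w = sum_list (map sgn w)"

lemma exponent_sum_append [simp]: "exponent_sum (u @ v) = exponent_sum u + exponent_sum v"
  and exponent_sum_Nil [simp]: "exponent_sum [] = 0"
  and exponent_sum_Cons [simp]: "exponent_sum (k # w) = sgn k + exponent_sum w"
  by (simp_all add: exponent_sum_def)

lemma exponent_sum_equiv: "braid_equiv w v \<Longrightarrow> exponent_sum w = exponent_sum v"
proof (induction rule: braid_equiv.induct)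
  case (basic x y u v)
  then show ?case by cases simp_all
qed auto

abbreviation small_letters :: "nat \<Rightarrow> braid_word \<Rightarrow> bool" where
  "small_letters n w \<equiv> (\<forall>k\<in>set w. k \<noteq> 0 \<and> \<bar>k\<bar> < int n)"

context r_matrix
begin

text \<open>The weights \<open>q^(m - 1 - 2 x)\<close> of the quantum trace make the partial trace of an R-matrix
  scalar.\<close>

definition mu :: "nat \<Rightarrow> real" where "mu x = q ^ m * (1 / q) ^ (2 * x + 1)"

definition weight :: "nat \<Rightarrow> (nat \<Rightarrow> nat) \<Rightarrow> real" where
  "weight n s = (\<Prod>j<n. mu (s j))"

definition trace :: "nat \<Rightarrow> braid_word \<Rightarrow> real" where
  "trace n w = (\<Sum>s\<in>states m n. weight n s * act w (delta s) s)"

text \<open>The quantum dimension (q^m - q^(-m)) / z of the representation.\<close>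

definition loop_value :: real where "loop_value = (\<Sum>y<m. mu y)"

definition a :: real where "a = (1 / q) ^ m"

lemma a_pos: "a > 0"
  using q_pos by (simp add: a_def)

lemma a_inverse: "q ^ m = 1 / a"
  using q_pos by (simp add: a_def power_one_over)

lemma mu_pos: "mu x > 0"
  using q_pos by (simp add: mu_def)

lemma loop_value_pos: "loop_value > 0"
  unfolding loop_value_def using m_pos by (intro sum_pos) (auto simp: mu_pos)

lemma z_mu: "z * mu x = q ^ m * (1 / q) ^ (2 * x) - q ^ m * (1 / q) ^ (2 * Suc x)"
  using q_pos by (simp add: mu_def z_def field_simps)

lemma q_mu: "q * mu x = q ^ m * (1 / q) ^ (2 * x)"
  using q_pos by (simp add: mu_def)

lemma z_loop_value: "z * loop_value = 1 / a - a"
proof -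
  have "z * (\<Sum>y<k. mu y) = q ^ m - q ^ m * (1 / q) ^ (2 * k)" for k
    by (induction k) (simp_all add: distrib_left z_mu)
  moreover have "q ^ m * (1 / q) ^ (2 * m) = a"
    using q_pos by (simp add: a_def power_one_over power_mult power2_eq_square power_mult_distrib field_simps)
  ultimately show ?thesis by (simp add: loop_value_def a_inverse)
qed

text \<open>The terms with \<open>y < x\<close> telescope by \<open>z_mu\<close> to q^m - q^(m -
  2x), and the term \<open>y = x\<close> adds the missing q^(m - 2x). The result does not depend on
  \<open>x\<close>, which is what stabilisation requires.\<close>

lemma sum_mu_diag:
  assumes "x < m"
  shows "(\<Sum>y<m. mu y * diag 1 x y) = 1 / a"
proof -
  have "(\<Sum>y<k. mu y * diag 1 x y) = (if x < k then q ^ m else q ^ m - q ^ m * (1 / q) ^ (2 * k))" for k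
  proof (induction k)
    case (Suc k)
    consider "x < k" | "x = k" | "x > k" by linarith
    then show ?case
      using Suc z_mu[of k] q_mu[of k]
      by cases (simp_all add: diag_def mult.commute)
  qed simp
  then show ?thesis using assms by (simp add: a_inverse)
qed

text \<open>R is symmetric, so the coefficients can be read off at the fixed state \<open>s\<close>
  and pulled out of the linear map \<open>act w\<close>.\<close>

lemma op_delta:
  "op k (delta s) t = diag k (s (site k)) (s (Suc (site k))) * delta s t
    + (if s (site k) = s (Suc (site k)) then 0 else 1) * delta (swap_adj (site k) s) t"
proof -
  have "delta s (swap_adj j t) = delta (swap_adj j s) t" for j
    unfolding delta_def by (metis swap_adj_involution)
  moreover have "delta (swap_adj (site k) s) t = 0"
    if "(s (site k) = s (Suc (site k))) \<noteq> (t (site k) = t (Suc (site k)))"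
    using that by (auto simp: delta_def swap_adj_def)
  ultimately show ?thesis by (auto simp: op_def delta_def)
qed

text \<open>The weight is a symmetric product over the strands, so it commutes with every crossing;
  this makes the weighted trace cyclic.\<close>

lemma weight_swap_adj:
  assumes "Suc j < n"
  shows "weight n (swap_adj j s) = weight n s"
proof -
  have bij: "bij_betw (transpose j (Suc j)) {..<n} {..<n}"
    using assms by (intro bij_betw_byWitness[where f' = "transpose j (Suc j)"])
      (auto simp: transpose_def)
  have "swap_adj j s x = s (transpose j (Suc j) x)" for x
    by (auto simp: swap_adj_def transpose_def)
  then show ?thesis
    unfolding weight_def using prod.reindex_bij_betw[OF bij, of "\<lambda>x. mu (s x)"] by simp
qed

lemma trace_rotate1:
  assumes "k \<noteq> 0" "\<bar>k\<bar> < int n"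
  shows "trace n (k # w) = trace n (w @ [k])"
proof -
  define j where "j = site k"
  have j: "Suc j < n" using assms by (simp add: j_def site_def)
  define d where "d s = diag k (s j) (s (Suc j))" for s :: "nat \<Rightarrow> nat"
  define b where "b s = (if s j = s (Suc j) then 0 else 1 :: real)" for s :: "nat \<Rightarrow> nat"
  have b_swap: "b (swap_adj j s) = b s" for s by (auto simp: b_def swap_adj_def)
  have L: "act (k # w) (delta s) s = d s * act w (delta s) s + b s * act w (delta s) (swap_adj j s)" for s
    by (simp add: act_Cons op_def j_def[symmetric] d_def b_def)
  have R: "act (w @ [k]) (delta s) s = d s * act w (delta s) s + b s * act w (delta (swap_adj j s)) s" for s
    unfolding act_append act_Cons act_Nil op_delta[abs_def] j_def[symmetric] act_add act_scale d_def b_def ..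
  \<comment> \<open>The diagonal parts of \<open>L\<close> and \<open>R\<close> agree termwise; the
    off-diagonal parts agree after the substitution \<open>swap_adj j\<close>.\<close>
  have "(\<Sum>s\<in>states m n. weight n s * (b s * act w (delta s) (swap_adj j s)))
      = (\<Sum>s\<in>states m n. weight n s * (b s * act w (delta (swap_adj j s)) s))"
    by (rule sum.reindex_bij_witness[where i = "swap_adj j" and j = "swap_adj j"])
      (auto simp: swap_adj_states[OF j] weight_swap_adj[OF j] b_swap)
  then show ?thesis by (simp add: trace_def L R distrib_left sum.distrib)
qed

lemma trace_conj:
  assumes "small_letters n u"
  shows "trace n (u @ v) = trace n (v @ u)"
  using assms
proof (induction u arbitrary: v)
  case (Cons k u)
  have "trace n (k # (u @ v)) = trace n (u @ (v @ [k]))"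
    using trace_rotate1[of k n "u @ v"] Cons.prems by simp
  also have "\<dots> = trace n ((v @ [k]) @ u)" using Cons by simp
  finally show ?case by simp
qed simp

text \<open>Letters below \<open>n\<close> never change the indices from \<open>n\<close> on, so
  only states with the same tail as \<open>s\<close> are reached.\<close>

lemma act_local:
  assumes "small_letters n w" "\<And>t. (\<forall>j\<ge>n. t j = s j) \<Longrightarrow> \<phi> t = \<psi> t"
  shows "act w \<phi> s = act w \<psi> s"
  using assms
proof (induction w arbitrary: s)
  case (Cons k w)
  define j where "j = site k"
  have "Suc j < n" using Cons.prems(1) by (auto simp: j_def site_def)
  then have sw: "\<forall>i\<ge>n. swap_adj j s i = s i" by (auto simp: swap_adj_def)
  have "act w \<phi> s = act w \<psi> s" using Cons by simp
  moreover have "act w \<phi> (swap_adj j s) = act w \<psi> (swap_adj j s)"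
    using Cons sw by simp
  ultimately show ?case by (simp add: act_Cons op_def j_def[symmetric])
qed simp

lemma act_fun_upd:
  assumes "small_letters n w"
  shows "act w \<phi> (s(n := y)) = act w (\<lambda>t. \<phi> (t(n := y))) s"
  using assms
proof (induction w arbitrary: s)
  case (Cons k w)
  define j where "j = site k"
  have j: "Suc j < n" using Cons.prems(1) by (auto simp: j_def site_def)
  then have sw: "swap_adj j (s(n := y)) = (swap_adj j s)(n := y)" by (auto simp: swap_adj_def)
  have IH: "act w \<phi> (s(n := y)) = act w (\<lambda>t. \<phi> (t(n := y))) s" for s
    by (rule Cons.IH) (use Cons.prems in simp)
  have at: "(s(n := y)) j = s j" "(s(n := y)) (Suc j) = s (Suc j)" using j by simp_all
  show ?case unfolding act_Cons op_def j_def[symmetric] sw IH at ..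
qed simp

lemma weight_fun_upd: "weight (Suc n) (t(n := y)) = weight n t * mu y"
  by (simp add: weight_def)

lemma trace_unlink:
  assumes "small_letters n w"
  shows "trace (Suc n) w = loop_value * trace n w"
proof -
  have "act w (delta (t(n := y))) (t(n := y)) = act w (delta t) t" for t y
    unfolding act_fun_upd[OF assms]
  proof (rule act_local[OF assms])
    fix t' assume "\<forall>j\<ge>n. t' j = t j"
    then have "t'(n := y) = t(n := y) \<longleftrightarrow> t' = t" by (metis fun_upd_triv fun_upd_upd le_refl)
    then show "delta (t(n := y)) (t'(n := y)) = delta t t'" by (simp add: delta_def)
  qed
  then show ?thesis
    unfolding trace_def sum_states_Suc loop_value_def
    by (simp add: weight_fun_upd sum_distrib_left sum_distrib_right mult_ac)
qed

lemma trace_stab: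
  assumes "small_letters n w" "n \<ge> 1"
  shows "trace (Suc n) (w @ [int n]) = trace n w / a"
proof -
  have "act (w @ [int n]) (delta (t(n := y))) (t(n := y)) = diag 1 (t (n - 1)) y * act w (delta t) t" for t y
  proof -
    have "act w (op (int n) (delta (t(n := y)))) (t(n := y))
        = act w (\<lambda>t'. op (int n) (delta (t(n := y))) (t'(n := y))) t"
      by (rule act_fun_upd[OF assms(1)])
    also have "\<dots> = act w (\<lambda>t'. diag 1 (t (n - 1)) y * delta t t') t"
    proof (rule act_local[OF assms(1)])
      fix t' assume *: "\<forall>j\<ge>n. t' j = t j"
      have "t'(n := y) = t(n := y) \<longleftrightarrow> t' = t" using * by (metis fun_upd_triv fun_upd_upd le_refl)
      \<comment> \<open>The off-diagonal term would put an index other than \<open>y\<close> on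
        strand \<open>n\<close>, where \<open>delta\<close> demands \<open>y\<close>. Only the
        diagonal entry survives, and its sum over \<open>y\<close> is known from
        \<open>sum_mu_diag\<close>.\<close>
      moreover have "(t'(n := y, n - 1 := y, n := t' (n - 1))) n \<noteq> (t(n := y)) n" if "t' (n - 1) \<noteq> y"
        using that by simp
      then have "t'(n := y, n - 1 := y, n := t' (n - 1)) \<noteq> t(n := y)" if "t' (n - 1) \<noteq> y"
        using that by metis
      ultimately show "op (int n) (delta (t(n := y))) (t'(n := y)) = diag 1 (t (n - 1)) y * delta t t'"
        using assms(2) by (auto simp: op_at_pair delta_def)
    qed
    finally show ?thesis by (simp add: act_append act_Cons act_scale)
  qed
  then have "trace (Suc n) (w @ [int n])
      = (\<Sum>t\<in>states m n. weight n t * act w (delta t) t * (\<Sum>y<m. mu y * diag 1 (t (n - 1)) y))"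
    unfolding trace_def sum_states_Suc by (simp add: weight_fun_upd sum_distrib_left mult_ac)
  also have "\<dots> = (\<Sum>t\<in>states m n. weight n t * act w (delta t) t * (1 / a))"
  proof (rule sum.cong[OF HOL.refl])
    fix t assume "t \<in> states m n"
    then have "t (n - 1) < m" using assms(2) by (auto simp: states_def PiE_iff)
    then show "weight n t * act w (delta t) t * (\<Sum>y<m. mu y * diag 1 (t (n - 1)) y)
      = weight n t * act w (delta t) t * (1 / a)" by (simp only: sum_mu_diag)
  qed
  finally show ?thesis by (simp add: trace_def sum_divide_distrib)
qed

lemma trace_square:
  assumes "i > 0"
  shows "trace n (w @ [i, i]) = trace n w + z * trace n (w @ [i])"
  by (simp add: trace_def act_append act_Cons op_square[OF assms] act_add act_scale distrib_left
      sum.distrib sum_distrib_left mult_ac)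

lemma trace_neg:
  assumes "i > 0"
  shows "trace n (w @ [- i]) = trace n (w @ [i]) - z * trace n w"
  by (simp add: trace_def act_append act_Cons op_neg[OF assms] act_diff act_scale
      right_diff_distrib sum_subtractf sum_distrib_left mult_ac)

text \<open>The power of the exponent sum cancels the factor 1/a of a positive stabilisation, and
  the divisor normalises the unknot to 1.\<close>

definition val :: "nat \<Rightarrow> braid_word \<Rightarrow> real" where
  "val n w = a powi exponent_sum w * trace n w / loop_value"

lemma val_equiv: "braid_equiv w v \<Longrightarrow> val n w = val n v"
  by (simp add: val_def trace_def act_equiv exponent_sum_equiv)

lemma val_conj:
  assumes "small_letters n u"
  shows "val n (u @ v) = val n (v @ u)"
  unfolding val_def trace_conj[OF assms] exponent_sum_append by (simp only: add.commute)

lemma val_unlink: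
  assumes "small_letters n w"
  shows "val (Suc n) w = (1 / a - a) / z * val n w"
proof -
  have "(1 / a - a) / z = loop_value"
    using z_nonzero z_loop_value by (simp add: field_simps)
  then show ?thesis by (simp add: val_def trace_unlink[OF assms])
qed

lemma val_stab: "small_letters n w \<Longrightarrow> n \<ge> 1 \<Longrightarrow> val (Suc n) (w @ [int n]) = val n w"
  using a_pos by (simp add: val_def trace_stab power_int_add)

text \<open>From R^(-1) = R - z the partial trace is 1/a - z * \<open>loop_value\<close> = a, which
  the exponent -1 of a cancels.\<close>

lemma val_stab_neg:
  assumes "small_letters n w" "n \<ge> 1"
  shows "val (Suc n) (w @ [- int n]) = val n w"
proof -
  have "trace (Suc n) (w @ [- int n]) = trace n w / a - z * loop_value * trace n w"
    using assms by (simp add: trace_neg trace_stab trace_unlink)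
  also have "\<dots> = a * trace n w" by (simp add: z_loop_value algebra_simps)
  finally show ?thesis
    using a_pos assms(2) by (simp add: val_def power_int_diff field_simps)
qed

lemma val_square: "i > 0 \<Longrightarrow> val n (w @ [i, i]) = a ^ 2 * val n w + a * z * val n (w @ [i])"
  using a_pos by (simp add: val_def trace_square power_int_add add_divide_distrib power2_eq_square algebra_simps)

lemma val_neg: "i > 0 \<Longrightarrow> val n (w @ [- i]) = val n (w @ [i]) / a ^ 2 - z / a * val n w"
  using a_pos loop_value_pos
  by (simp add: val_def trace_neg power_int_add power_int_diff power2_eq_square field_simps)

lemma val_unknot: "val 1 [] = 1"
proof -
  \<comment> \<open>On zero strands there is one state, of empty weight; adding one split strand
    gives the unknot.\<close>
  have "trace 0 [] = 1" by (simp add: trace_def states_def weight_def delta_def)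
  then show ?thesis using trace_unlink[of "[]" 0] loop_value_pos by (simp add: val_def)
qed

end

section \<open>Existence\<close>

abbreviation finite_support :: "laurent2 \<Rightarrow> bool" where
  "finite_support f \<equiv> finite {(i, j). f i j \<noteq> 0}"

definition laurent_eval :: "laurent2 \<Rightarrow> real \<Rightarrow> real \<Rightarrow> real" where
  "laurent_eval f a z = (\<Sum>(i, j)\<in>{(i, j). f i j \<noteq> 0}. of_int (f i j) * a powi i * z powi j)"

text \<open>Multiplication by a^p z^r.\<close>

definition laurent_shift :: "int \<Rightarrow> int \<Rightarrow> laurent2 \<Rightarrow> laurent2" where
  "laurent_shift p r f = (\<lambda>i j. f (i - p) (j - r))"

lemma laurent_eval_superset:
  assumes "finite X" "{(i, j). f i j \<noteq> 0} \<subseteq> X"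
  shows "laurent_eval f a z = (\<Sum>(i, j)\<in>X. of_int (f i j) * a powi i * z powi j)"
  unfolding laurent_eval_def using assms by (intro sum.mono_neutral_left) auto

lemma finite_support_shift:
  assumes "finite_support f"
  shows "finite_support (laurent_shift p r f)"
proof (rule finite_subset)
  show "{(i, j). laurent_shift p r f i j \<noteq> 0} \<subseteq> (\<lambda>(i, j). (i + p, j + r)) ` {(i, j). f i j \<noteq> 0}"
    by (force simp: laurent_shift_def image_iff)
qed (use assms in simp)

lemma laurent_eval_shift:
  assumes "a \<noteq> 0" "z \<noteq> 0"
  shows "laurent_eval (laurent_shift p r f) a z = a powi p * z powi r * laurent_eval f a z"
proof -
  have "laurent_eval (laurent_shift p r f) a z
      = (\<Sum>(i, j)\<in>{(i, j). f i j \<noteq> 0}. of_int (f i j) * a powi (i + p) * z powi (j + r))"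
    unfolding laurent_eval_def laurent_shift_def
    by (rule sum.reindex_bij_witness[where i = "\<lambda>(i, j). (i + p, j + r)" and j = "\<lambda>(i, j). (i - p, j - r)"]) auto
  also have "\<dots> = a powi p * z powi r * laurent_eval f a z"
    using assms by (simp add: laurent_eval_def sum_distrib_left power_int_add case_prod_unfold mult_ac)
  finally show ?thesis .
qed

lemma finite_support_combine:
  assumes "finite_support f" "finite_support g"
  shows "finite_support (\<lambda>i j. f i j + g i j)" "finite_support (\<lambda>i j. f i j - g i j)"
  by (rule finite_subset[OF _ finite_UnI[OF assms]], force)+

lemma laurent_eval_combine:
  assumes "finite_support f" "finite_support g"
  shows "laurent_eval (\<lambda>i j. f i j + g i j) a z = laurent_eval f a z + laurent_eval g a z"
    and "laurent_eval (\<lambda>i j. f i j - g i j) a z = laurent_eval f a z - laurent_eval g a z"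
proof -
  define X where "X = {(i, j). f i j \<noteq> 0} \<union> {(i, j). g i j \<noteq> 0}"
  have X: "finite X" using assms by (simp add: X_def)
  note E = laurent_eval_superset[OF X]
  have f: "laurent_eval f a z = (\<Sum>(i, j)\<in>X. of_int (f i j) * a powi i * z powi j)"
    and g: "laurent_eval g a z = (\<Sum>(i, j)\<in>X. of_int (g i j) * a powi i * z powi j)"
    by (rule E; force simp: X_def)+
  have "laurent_eval (\<lambda>i j. f i j + g i j) a z = (\<Sum>(i, j)\<in>X. of_int (f i j + g i j) * a powi i * z powi j)"
    by (rule E) (force simp: X_def)
  then show "laurent_eval (\<lambda>i j. f i j + g i j) a z = laurent_eval f a z + laurent_eval g a z"
    by (simp add: f g sum.distrib[symmetric] case_prod_unfold algebra_simps)
  have "laurent_eval (\<lambda>i j. f i j - g i j) a z = (\<Sum>(i, j)\<in>X. of_int (f i j - g i j) * a powi i * z powi j)"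
    by (rule E) (force simp: X_def)
  then show "laurent_eval (\<lambda>i j. f i j - g i j) a z = laurent_eval f a z - laurent_eval g a z"
    by (simp add: f g sum_subtractf[symmetric] case_prod_unfold algebra_simps)
qed

text \<open>Multiplying by a high power x^M clears the negative exponents and leaves a polynomial
  with infinitely many roots.\<close>

lemma laurent_coeffs_zero:
  fixes c :: "int \<Rightarrow> real"
  assumes "finite I" "infinite X" "\<And>x. x \<in> X \<Longrightarrow> x \<noteq> 0"
    and "\<And>x. x \<in> X \<Longrightarrow> (\<Sum>i\<in>I. c i * x powi i) = 0" and "k \<in> I"
  shows "c k = 0"
proof -
  obtain M :: nat where M: "\<forall>i\<in>I. 0 \<le> i + int M"
  proof
    show "\<forall>i\<in>I. 0 \<le> i + int (\<Sum>i\<in>I. nat \<bar>i\<bar>)"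
    proof
      fix i assume "i \<in> I"
      then have "nat \<bar>i\<bar> \<le> (\<Sum>i\<in>I. nat \<bar>i\<bar>)" using assms(1) by (intro member_le_sum) auto
      then show "0 \<le> i + int (\<Sum>i\<in>I. nat \<bar>i\<bar>)" by linarith
    qed
  qed
  define p where "p = (\<Sum>i\<in>I. monom (c i) (nat (i + int M)))"
  have "poly p x = 0" if "x \<in> X" for x
  proof -
    have "poly p x = (\<Sum>i\<in>I. x ^ M * (c i * x powi i))"
      unfolding p_def poly_sum poly_monom
    proof (rule sum.cong[OF HOL.refl])
      fix i assume "i \<in> I"
      then have "x ^ nat (i + int M) = x powi (i + int M)" using M by (simp add: power_int_def)
      then show "c i * x ^ nat (i + int M) = x ^ M * (c i * x powi i)"
        using assms(3)[OF that] by (simp add: power_int_add)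
    qed
    then show ?thesis using assms(4)[OF that] by (simp add: sum_distrib_left[symmetric])
  qed
  then have "X \<subseteq> {x. poly p x = 0}" by auto
  then have "p = 0" using assms(2) poly_roots_finite finite_subset by blast
  then have "0 = coeff p (nat (k + int M))" by simp
  also have "\<dots> = (\<Sum>i\<in>I. if i = k then c i else 0)"
    unfolding p_def coeff_sum coeff_monom using M assms(5) by (intro sum.cong) (auto simp: nat_eq_iff)
  also have "\<dots> = c k" using assms(1,5) by simp
  finally show ?thesis by simp
qed

definition same_values :: "laurent2 \<Rightarrow> laurent2 \<Rightarrow> bool" where
  "same_values f g \<longleftrightarrow> (\<forall>q m. r_matrix q m \<longrightarrow>
     laurent_eval f (r_matrix.a q m) (r_matrix.z q) = laurent_eval g (r_matrix.a q m) (r_matrix.z q))"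

text \<open>For fixed q > 1, varying m gives infinitely many values of a, so each a-coefficient of
  the difference vanishes at z = q - 1/q. This map is injective on q > 1, so these coefficients,
  Laurent polynomials in z, vanish as well.\<close>

lemma laurent_eqI:
  assumes "finite_support f" "finite_support g" "same_values f g"
  shows "f = g"
proof -
  define h where "h = (\<lambda>i j. f i j - g i j)"
  have h: "finite_support h" unfolding h_def by (rule finite_support_combine[OF assms(1,2)])
  define I J where "I = fst ` {(i, j). h i j \<noteq> 0}" and "J = snd ` {(i, j). h i j \<noteq> 0}"
  have fin: "finite I" "finite J" using h by (simp_all add: I_def J_def)
  have sub: "{(i, j). h i j \<noteq> 0} \<subseteq> I \<times> J" by (force simp: I_def J_def)
  have zero: "(\<Sum>i\<in>I. (\<Sum>j\<in>J. of_int (h i j) * r_matrix.z q powi j) * r_matrix.a q m powi i) = 0"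
    if "r_matrix q m" for q m
  proof -
    have "0 = laurent_eval h (r_matrix.a q m) (r_matrix.z q)"
      using assms(3) that unfolding h_def laurent_eval_combine[OF assms(1,2)] same_values_def by simp
    also have "\<dots> = (\<Sum>(i, j)\<in>I \<times> J. of_int (h i j) * r_matrix.a q m powi i * r_matrix.z q powi j)"
      by (rule laurent_eval_superset) (use fin sub in auto)
    also have "\<dots> = (\<Sum>i\<in>I. \<Sum>j\<in>J. of_int (h i j) * r_matrix.a q m powi i * r_matrix.z q powi j)"
      by (rule sum.cartesian_product[symmetric])
    finally show ?thesis by (simp add: sum_distrib_left sum_distrib_right mult_ac)
  qed
  have rm: "r_matrix q m" if "q > 1" "m > 0" for q m using that by unfold_locales auto
  have inner: "(\<Sum>j\<in>J. of_int (h i j) * r_matrix.z q powi j) = 0" if "q > 1" "i \<in> I" for q i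
  proof (rule laurent_coeffs_zero[OF fin(1) _ _ _ that(2)])
    have "inj (\<lambda>m. (1 / q) ^ Suc m)"
      using that(1) by (intro injI) (simp add: power_one_over)
    then show "infinite (range (\<lambda>m. (1 / q) ^ Suc m))" by (simp add: finite_image_iff)
  next
    fix x assume "x \<in> range (\<lambda>m. (1 / q) ^ Suc m)"
    then obtain m where x: "x = (1 / q) ^ Suc m" by blast
    show "x \<noteq> 0" using that(1) x by simp
    have "r_matrix.a q (Suc m) = x" using rm[OF that(1), of "Suc m"] x by (simp add: r_matrix.a_def)
    then show "(\<Sum>i\<in>I. (\<Sum>j\<in>J. of_int (h i j) * r_matrix.z q powi j) * x powi i) = 0"
      using zero[OF rm[OF that(1), of "Suc m"]] by simp
  qed
  have "h i j = 0" for i j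
  proof (rule ccontr)
    assume nz: "h i j \<noteq> 0"
    then have ij: "i \<in> I" "j \<in> J" by (force simp: I_def J_def)+
    have "real_of_int (h i j) = 0"
    proof (rule laurent_coeffs_zero[OF fin(2) _ _ _ ij(2)])
      have "inj_on r_matrix.z {1<..}"
      proof (rule inj_onI)
        fix x y :: real
        assume xy: "x \<in> {1<..}" "y \<in> {1<..}" "r_matrix.z x = r_matrix.z y"
        then have "x - 1 / x = y - 1 / y" by (simp only: r_matrix.z_def[OF rm[of x 1]] r_matrix.z_def[OF rm[of y 1]] greaterThan_iff zero_less_one)
        then have "(x - 1 / x) * (x * y) = (y - 1 / y) * (x * y)" by simp
        moreover have "(x - 1 / x) * (x * y) = x * x * y - y" "(y - 1 / y) * (x * y) = x * y * y - x"
          using xy(1,2) by (simp_all add: left_diff_distrib)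
        ultimately have "(x - y) * (x * y + 1) = 0" by (simp add: algebra_simps)
        moreover have "x * y + 1 > 0" using xy by (simp add: add_pos_pos)
        ultimately show "x = y" by simp
      qed
      then show "infinite (r_matrix.z ` {1<..})" by (simp add: finite_image_iff infinite_Ioi)
    next
      fix x assume "x \<in> r_matrix.z ` {1<..}"
      then obtain q where q: "q > 1" "x = r_matrix.z q" by auto
      show "x \<noteq> 0" using r_matrix.z_nonzero[OF rm[OF q(1), of 1]] q(2) by simp
      show "(\<Sum>j\<in>J. real_of_int (h i j) * x powi j) = 0"
        using inner[OF q(1) ij(1)] q(2) by simp
    qed
    then show False using nz by simp
  qed
  then show ?thesis by (simp add: h_def fun_eq_iff)
qed

section \<open>From values to the polynomial\<close>

definition represents :: "nat \<Rightarrow> braid_word \<Rightarrow> laurent2 \<Rightarrow> bool" where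
  "represents n w f \<longleftrightarrow> finite_support f \<and>
     (\<forall>q m. r_matrix q m \<longrightarrow> laurent_eval f (r_matrix.a q m) (r_matrix.z q) = r_matrix.val q m n w)"

lemma represents_unknot: "represents 1 [] laurent_one"
proof -
  have supp: "{(i, j). laurent_one i j \<noteq> 0} = {(0, 0)}"
    by (auto simp: laurent_one_def split: if_splits)
  have "laurent_eval laurent_one a z = 1" for a z
    unfolding laurent_eval_def supp by (simp add: laurent_one_def)
  then show ?thesis unfolding represents_def supp by (simp add: r_matrix.val_unknot[unfolded One_nat_def])
qed

lemma small_lettersI: "valid_braid n w \<Longrightarrow> small_letters n w"
  by (simp add: valid_braid_def)

text \<open>Each induction case combines the values with integer Laurent monomials as factors; the
  division by z for a split strand is harmless because negative powers of z are allowed.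
  Independence of the reduction is not at issue here, as the values are already invariants.\<close>

lemma represents_exists:
  assumes "valid_braid n w"
  shows "\<exists>f. represents n w f"
  using assms
proof (induction rule: homfly_induct)
  case unknot
  show ?case using represents_unknot by blast
next
  case (equiv n w v)
  then show ?case unfolding represents_def using r_matrix.val_equiv[OF _ equiv(3)] by metis
next
  case (conj n u v)
  have "small_letters n u" using conj(1) small_lettersI[of n u] by simp
  then show ?case using conj(2) unfolding represents_def using r_matrix.val_conj[of _ _ u n v] by metis
next
  case (stab n w)
  have n: "n \<ge> 1" using stab(1) by (simp add: valid_braid_def)
  show ?case
    using stab(2) r_matrix.val_stab[OF _ small_lettersI[OF stab(1)] n] unfolding represents_def by metis
next
  case (unlink n w)
  then obtain f where f: "represents n w f" by blast
  define g where "g = (\<lambda>i j. laurent_shift (- 1) (- 1) f i j - laurent_shift 1 (- 1) f i j)"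
  have fin: "finite_support (laurent_shift p r f)" for p r
    using f finite_support_shift by (simp add: represents_def)
  have "laurent_eval g (r_matrix.a q m) (r_matrix.z q) = r_matrix.val q m (Suc n) w"
    if "r_matrix q m" for q m
  proof -
    interpret r_matrix q m by (rule that)
    have "a \<noteq> 0" using a_pos by simp
    then show ?thesis
      using f that z_nonzero unfolding g_def laurent_eval_combine[OF fin fin] represents_def
      by (simp add: laurent_eval_shift val_unlink[OF small_lettersI[OF unlink(1)]] field_simps)
  qed
  moreover have "finite_support g" unfolding g_def by (rule finite_support_combine[OF fin fin])
  ultimately show ?case unfolding represents_def by blast
next
  case (skein n w i)
  then obtain f g where f: "represents n w f" and g: "represents n (w @ [i]) g" by blast
  define h where "h = (\<lambda>k l. laurent_shift 2 0 f k l + laurent_shift 1 1 g k l)"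
  have fin: "finite_support (laurent_shift p r f)" "finite_support (laurent_shift p r g)" for p r
    using f g finite_support_shift by (simp_all add: represents_def)
  have "laurent_eval h (r_matrix.a q m) (r_matrix.z q) = r_matrix.val q m n (w @ [i, i])"
    if "r_matrix q m" for q m
  proof -
    interpret r_matrix q m by (rule that)
    have "a \<noteq> 0" using a_pos by simp
    then show ?thesis
      using f g that z_nonzero skein(2) unfolding h_def laurent_eval_combine[OF fin] represents_def
      by (simp add: laurent_eval_shift val_square)
  qed
  moreover have "finite_support h" unfolding h_def by (rule finite_support_combine[OF fin])
  ultimately show ?case unfolding represents_def by blast
next
  case (skein_neg n w i)
  then obtain f g where f: "represents n w f" and g: "represents n (w @ [i]) g" by blast
  define h where "h = (\<lambda>k l. laurent_shift (- 2) 0 g k l - laurent_shift (- 1) 1 f k l)"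
  have fin: "finite_support (laurent_shift p r g)" "finite_support (laurent_shift p r f)" for p r
    using f g finite_support_shift by (simp_all add: represents_def)
  have "laurent_eval h (r_matrix.a q m) (r_matrix.z q) = r_matrix.val q m n (w @ [- i])"
    if "r_matrix q m" for q m
  proof -
    interpret r_matrix q m by (rule that)
    have "a \<noteq> 0" using a_pos by simp
    then show ?thesis
      using f g that z_nonzero skein_neg(2) unfolding h_def laurent_eval_combine[OF fin] represents_def
      by (simp add: laurent_eval_shift val_neg power_int_minus field_simps)
  qed
  moreover have "finite_support h" unfolding h_def by (rule finite_support_combine[OF fin])
  ultimately show ?case unfolding represents_def by blast
qed

text \<open>Turns an invariance property of \<open>val\<close> into one of the polynomial that
  \<open>represents\<close> it.\<close>

lemma represents_eqI:
  assumes "represents n w f" "represents n' w' g"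
    and "\<And>q m. r_matrix q m \<Longrightarrow> r_matrix.val q m n w = r_matrix.val q m n' w'"
  shows "f = g"
  using assms by (intro laurent_eqI) (auto simp: represents_def same_values_def)

lemma is_homfly_exists: "\<exists>P. is_homfly P"
proof
  define P where "P n w = (if valid_braid n w then SOME f. represents n w f else (\<lambda>i j. 0))" for n w
  have P: "represents n w (P n w)" if "valid_braid n w" for n w
    using that represents_exists[OF that] by (simp add: P_def someI_ex)
  show "is_homfly P"
    unfolding is_homfly_def
  proof (intro conjI allI impI)
    fix n w assume "\<not> valid_braid n w"
    then show "P n w = (\<lambda>i j. 0)" by (simp add: P_def)
  next
    fix n w assume "valid_braid n w"
    then show "finite_support (P n w)" using P by (simp add: represents_def)
  next
    fix n w v assume *: "valid_braid n w \<and> valid_braid n v \<and> braid_equiv w v"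
    then show "P n w = P n v"
      using r_matrix.val_equiv by (intro represents_eqI[OF P P]) blast+
  next
    fix n u v assume *: "valid_braid n (u @ v)"
    then have "small_letters n u" using small_lettersI[of n u] by simp
    then show "P n (u @ v) = P n (v @ u)"
      using r_matrix.val_conj * by (intro represents_eqI[OF P P]) auto
  next
    fix n w assume *: "valid_braid n w"
    then have n: "n \<ge> 1" by (simp add: valid_braid_def)
    have v: "valid_braid (Suc n) (w @ [int n])" "valid_braid (Suc n) (w @ [- int n])"
      using valid_braid_Suc[OF *] n by auto
    show "P (n + 1) (w @ [int n]) = P n w"
      using represents_eqI[OF P[OF v(1)] P[OF *]] r_matrix.val_stab[OF _ small_lettersI[OF *] n] by simp
    show "P (n + 1) (w @ [- int n]) = P n w"
      using represents_eqI[OF P[OF v(2)] P[OF *]] r_matrix.val_stab_neg[OF _ small_lettersI[OF *] n] by simp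
  next
    fix n w i and k l :: int
    assume *: "valid_braid n w \<and> 1 \<le> i \<and> i < int n"
    then have v: "valid_braid n w" "valid_braid n (w @ [i])" "valid_braid n (w @ [i, i])" by auto
    have fs: "finite_support (laurent_shift p r (P n w))" "finite_support (laurent_shift p r (P n (w @ [i])))"
      "finite_support (laurent_shift p r (P n (w @ [i, i])))" for p r
      using P[OF v(1)] P[OF v(2)] P[OF v(3)] finite_support_shift by (simp_all add: represents_def)
    \<comment> \<open>The skein relation as an identity of Laurent polynomials, from which the
      coefficient form is read off.\<close>
    have "(\<lambda>k l. laurent_shift (- 1) 0 (P n (w @ [i, i])) k l - laurent_shift 1 0 (P n w) k l)
        = laurent_shift 0 1 (P n (w @ [i]))"
    proof (rule laurent_eqI)
      show "same_values (\<lambda>k l. laurent_shift (- 1) 0 (P n (w @ [i, i])) k l - laurent_shift 1 0 (P n w) k l)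
        (laurent_shift 0 1 (P n (w @ [i])))"
        unfolding same_values_def laurent_eval_combine[OF fs(3) fs(1)]
      proof (intro allI impI)
        fix q m assume r: "r_matrix q m"
        interpret r_matrix q m by (rule r)
        have "a \<noteq> 0" using a_pos by simp
        then show "laurent_eval (laurent_shift (- 1) 0 (P n (w @ [i, i]))) a z
            - laurent_eval (laurent_shift 1 0 (P n w)) a z
            = laurent_eval (laurent_shift 0 1 (P n (w @ [i]))) a z"
          using P[OF v(1)] P[OF v(2)] P[OF v(3)] r z_nonzero *
          by (simp add: laurent_eval_shift represents_def val_square power2_eq_square field_simps)
      qed
    qed (use fs finite_support_combine in auto)
    from this[THEN fun_cong, THEN fun_cong, of k l]
    show "P n (w @ [i, i]) (k + 1) l - P n w (k - 1) l = P n (w @ [i]) k (l - 1)"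
      by (simp add: laurent_shift_def)
  next
    show "P 1 [] = laurent_one"
      by (rule represents_eqI[OF P represents_unknot]) auto
  qed
qed

lemma is_homfly_homfly: "is_homfly homfly"
  unfolding homfly_def using is_homfly_exists is_homfly_unique by (metis theI)

section \<open>Twisting two strands modulo p\<close>

definition z_eval :: "nat \<Rightarrow> (int \<Rightarrow> int) \<Rightarrow> int" where
  "z_eval N f = (\<Sum>j\<in>{j. j \<ge> 0 \<and> f j \<noteq> 0}. f j * int N ^ nat j)"

lemma homfly_at_z_eval: "homfly_at N n w i = z_eval N (homfly n w i)"
  by (simp add: homfly_at_def z_eval_def)

lemma z_eval_superset:
  assumes "finite X" "X \<subseteq> {0..}" "\<And>j. j \<ge> 0 \<Longrightarrow> f j \<noteq> 0 \<Longrightarrow> j \<in> X"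
  shows "z_eval N f = (\<Sum>j\<in>X. f j * int N ^ nat j)"
  unfolding z_eval_def using assms by (intro sum.mono_neutral_left) auto

lemma z_eval_linear:
  assumes "finite {j. f j \<noteq> 0}" "finite {j. g j \<noteq> 0}"
  shows "z_eval N (\<lambda>j. a * f j + b * g j) = a * z_eval N f + b * z_eval N g"
proof -
  define X where "X = {j. j \<ge> 0 \<and> (f j \<noteq> 0 \<or> g j \<noteq> 0)}"
  have "X \<subseteq> {j. f j \<noteq> 0} \<union> {j. g j \<noteq> 0}" by (auto simp: X_def)
  then have X: "finite X" "X \<subseteq> {0..}" using assms finite_subset by (auto simp: X_def)
  have "z_eval N (\<lambda>j. a * f j + b * g j) = (\<Sum>j\<in>X. (a * f j + b * g j) * int N ^ nat j)"
    by (rule z_eval_superset[OF X]) (auto simp: X_def)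
  moreover have "z_eval N f = (\<Sum>j\<in>X. f j * int N ^ nat j)" "z_eval N g = (\<Sum>j\<in>X. g j * int N ^ nat j)"
    by (rule z_eval_superset[OF X]; simp add: X_def)+
  ultimately show ?thesis by (simp add: sum_distrib_left sum.distrib[symmetric] algebra_simps)
qed

text \<open>Without the hypothesis, terms with negative exponent that the shift makes nonnegative
  would be counted on the left and dropped on the right.\<close>

lemma z_eval_shift:
  assumes "\<And>j. f j \<noteq> 0 \<Longrightarrow> j \<ge> 0"
  shows "z_eval N (\<lambda>j. f (j - int d)) = int N ^ d * z_eval N f"
proof -
  have "z_eval N (\<lambda>j. f (j - int d)) = (\<Sum>j\<in>{j. j \<ge> 0 \<and> f j \<noteq> 0}. f j * int N ^ nat (j + int d))"
    unfolding z_eval_def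
    by (rule sum.reindex_bij_witness[where i = "\<lambda>j. j + int d" and j = "\<lambda>j. j - int d"])
      (use assms in fastforce)+
  also have "\<dots> = (\<Sum>j\<in>{j. j \<ge> 0 \<and> f j \<noteq> 0}. int N ^ d * (f j * int N ^ nat j))"
    by (intro sum.cong) (auto simp: nat_add_distrib power_add)
  finally show ?thesis by (simp add: z_eval_def sum_distrib_left)
qed

lemma homfly_finite_z: "finite {j. homfly n w i j \<noteq> 0}"
proof (rule finite_subset)
  show "{j. homfly n w i j \<noteq> 0} \<subseteq> snd ` {(i, j). homfly n w i j \<noteq> 0}" by force
qed (simp add: is_homfly_finite[OF is_homfly_homfly])

lemma homfly_finite_a: "finite {i. homfly_at N n w i \<noteq> 0}"
proof (rule finite_subset)
  show "{i. homfly_at N n w i \<noteq> 0} \<subseteq> fst ` {(i, j). homfly n w i j \<noteq> 0}"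
  proof
    fix i assume "i \<in> {i. homfly_at N n w i \<noteq> 0}"
    then have "\<exists>j. homfly n w i j \<noteq> 0"
      unfolding homfly_at_def mem_Collect_eq by (rule contrapos_np) simp
    then show "i \<in> fst ` {(i, j). homfly n w i j \<noteq> 0}" by force
  qed
qed (simp add: is_homfly_finite[OF is_homfly_homfly])

lemma is_knot_braid_perm:
  assumes "is_knot_braid n w" "valid_braid n v" "braid_perm v = braid_perm w"
  shows "is_knot_braid n v"
  using assms by (simp add: is_knot_braid_def)

lemma braid_perm_replicate_even:
  assumes "\<bar>k\<bar> = 1"
  shows "braid_perm (w @ replicate (2 * t) k) = braid_perm w"
proof (induction t)
  case (Suc t)
  have "replicate (2 * Suc t) k = replicate (2 * t) k @ [k, k]"
    by (simp add: replicate_append_same[symmetric])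
  then have "braid_perm (w @ replicate (2 * Suc t) k) = braid_perm (w @ replicate (2 * t) k) \<circ> braid_perm [k, k]"
    by (metis append.assoc braid_perm_append)
  then show ?case using Suc by (simp add: braid_perm_Cons)
qed simp

lemma is_knot_braid_twist:
  assumes "is_knot_braid n w" "n \<ge> 2" "\<bar>k\<bar> = 1" "even d"
  shows "is_knot_braid n (w @ replicate d k)"
proof -
  obtain t where d: "d = 2 * t" using assms(4) by blast
  have "valid_braid n (replicate d k)" using assms by (auto simp: valid_braid_def)
  then show ?thesis
    using assms braid_perm_replicate_even[OF assms(3), of w t]
    by (intro is_knot_braid_perm[OF assms(1)]) (simp_all add: d is_knot_braid_def)
qed

text \<open>Iterating the skein relation so that only knots occur: here no negative powers of z get lost
  when evaluating at z = N.\<close>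

lemma homfly_at_recurrence:
  assumes "is_knot_braid n w" "n \<ge> 2"
  shows "homfly_at N n (w @ [1, 1, 1, 1]) i
    = (int N ^ 2 + 2) * homfly_at N n (w @ [1, 1]) (i - 2) - homfly_at N n w (i - 4)"
proof -
  have v: "valid_braid n w" "valid_braid n [1]" "1 < int n"
    using assms by (auto simp: is_knot_braid_def)
  note skein = is_homfly_skein[OF is_homfly_homfly _ order_refl v(3)]
  have h2: "homfly n (w @ [1, 1]) k l = homfly n w (k - 2) l + homfly n (w @ [1]) (k - 1) (l - 1)" for k l
    by (rule skein[OF v(1)])
  have h3: "homfly n (w @ [1, 1, 1]) k l = homfly n (w @ [1]) (k - 2) l + homfly n (w @ [1, 1]) (k - 1) (l - 1)" for k l
    using skein[of "w @ [1]" k l] v by simp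
  have h4: "homfly n (w @ [1, 1, 1, 1]) k l = homfly n (w @ [1, 1]) (k - 2) l + homfly n (w @ [1, 1, 1]) (k - 1) (l - 1)" for k l
    using skein[of "w @ [1, 1]" k l] v by simp
  define f g where "f = homfly n (w @ [1, 1]) (i - 2)" and "g = homfly n w (i - 4)"
  \<comment> \<open>Expanding \<open>h4\<close> by \<open>h3\<close> leaves one term a^3 z P(w s);
    by \<open>h2\<close> it equals a^2 P(w s^2) - a^4 P(w), which eliminates the closures that are
    not knots.\<close>
  have h: "homfly n (w @ [1, 1, 1, 1]) i = (\<lambda>l. 1 * (1 * f (l - int 2) + 2 * f l) + (- 1) * g l)"
    by (auto simp: fun_eq_iff h4 h3 f_def g_def h2[of "i - 2"])
  have "is_knot_braid n (w @ [1, 1])"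
    using is_knot_braid_twist[OF assms, of 1 2] by (simp add: numeral_2_eq_2)
  then have nn: "f j \<noteq> 0 \<Longrightarrow> j \<ge> 0" for j
    unfolding f_def using is_homfly_knot_z_nonneg[OF is_homfly_homfly] by blast
  have fin: "finite {j. f j \<noteq> 0}" "finite {j. g j \<noteq> 0}"
    by (simp_all add: f_def g_def homfly_finite_z)
  have fin2: "finite {j. f (j - int 2) \<noteq> 0}"
    by (rule finite_subset[OF _ finite_imageI[OF fin(1), of "\<lambda>j. j + 2"]]) (force simp: image_iff)
  have fin3: "finite {j. 1 * f (j - int 2) + 2 * f j \<noteq> 0}"
    by (rule finite_subset[OF _ finite_UnI[OF fin(1) fin2]]) auto
  have "z_eval N (\<lambda>j. f (j - int 2)) = int N ^ 2 * z_eval N f"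
    by (rule z_eval_shift) (rule nn)
  then have "homfly_at N n (w @ [1, 1, 1, 1]) i = (int N ^ 2 + 2) * z_eval N f - z_eval N g"
    unfolding homfly_at_z_eval h z_eval_linear[OF fin3 fin(2)] z_eval_linear[OF fin2 fin(1)]
    by (simp only:) (simp add: algebra_simps)
  then show ?thesis by (simp add: f_def g_def homfly_at_z_eval)
qed

text \<open>The step (x, y) -> (y, c y - x) on pairs of residues is invertible, hence a permutation
  of a finite set; its order is a period common to all solutions, with no preperiod.\<close>

lemma recurrence_period:
  fixes c :: int and p :: nat
  assumes "p > 0"
  shows "\<exists>L>0. \<forall>y :: nat \<Rightarrow> int. (\<forall>t. y (t + 2) mod int p = (c * y (t + 1) - y t) mod int p)
    \<longrightarrow> y L mod int p = y 0 mod int p"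
proof -
  define S where "S = {0..<int p} \<times> {0..<int p}"
  \<comment> \<open>The identity outside \<open>S\<close> makes \<open>f\<close> a permutation of
    the whole type.\<close>
  define f where "f = (\<lambda>(x, y). if (x, y) \<in> S then (y, (c * y - x) mod int p) else (x, y))"
  have "inj_on f S"
  proof (rule inj_onI)
    fix u v assume uv: "u \<in> S" "v \<in> S" "f u = f v"
    obtain x y x' y' where xy: "u = (x, y)" "v = (x', y')" by (cases u, cases v)
    have e: "y = y'" "(c * y - x) mod int p = (c * y - x') mod int p"
      using uv unfolding xy by (auto simp: f_def)
    then have "(c * y - (c * y - x)) mod int p = (c * y - (c * y - x')) mod int p"
      by (metis mod_diff_right_eq)
    then have "x mod int p = x' mod int p" by simp
    then show "u = v" using uv(1,2) e(1) unfolding xy by (simp add: S_def)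
  qed
  moreover have "f ` S \<subseteq> S" using assms by (auto simp: f_def S_def)
  moreover have fin: "finite S" by (simp add: S_def)
  ultimately have "bij_betw f S S" by (simp add: bij_betw_def endo_inj_surj)
  then have "f permutes S" by (rule bij_imp_permutes) (auto simp: f_def)
  then have "permutation f" using fin permutation_permutes by blast
  then obtain L where L: "f ^^ L = id" "L > 0" by (rule permutation_is_nilpotent)
  show ?thesis
  proof (intro exI conjI allI impI)
    show "L > 0" by (rule L(2))
    fix y :: "nat \<Rightarrow> int"
    assume y: "\<forall>t. y (t + 2) mod int p = (c * y (t + 1) - y t) mod int p"
    have "(f ^^ t) (y 0 mod int p, y 1 mod int p) = (y t mod int p, y (t + 1) mod int p)" for t
    proof (induction t)
      case (Suc t)
      have "(c * (y (t + 1) mod int p) - y t mod int p) mod int p = y (t + 2) mod int p"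
        using y by (metis mod_diff_eq mod_mod_trivial mod_mult_right_eq)
      then show ?case using Suc assms by (simp add: f_def S_def)
    qed simp
    from this[of L] show "y L mod int p = y 0 mod int p" by (simp add: L(1))
  qed
qed

lemma twist_period:
  fixes p :: nat
  assumes "p > 0"
  shows "\<exists>D>0. even D \<and> (\<forall>n w i. n \<ge> 2 \<longrightarrow> is_knot_braid n w \<longrightarrow>
    homfly_at N n (w @ replicate D 1) (i + int D) mod int p = homfly_at N n w i mod int p)"
proof -
  obtain L where L: "L > 0"
    "\<And>y :: nat \<Rightarrow> int. \<forall>t. y (t + 2) mod int p = ((int N ^ 2 + 2) * y (t + 1) - y t) mod int p
      \<Longrightarrow> y L mod int p = y 0 mod int p"
    using recurrence_period[OF assms, of "int N ^ 2 + 2"] by blast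
  show ?thesis
  proof (intro exI[of _ "2 * L"] conjI allI impI)
    fix n w i assume n: "n \<ge> (2 :: nat)" and w: "is_knot_braid n w"
    \<comment> \<open>Moving the index along with the number of crossings is the rescaling by
      a^(-2t); it turns the shifted coefficients of \<open>homfly_at_recurrence\<close> into a
      scalar recurrence.\<close>
    define y where "y t = homfly_at N n (w @ replicate (2 * t) 1) (i + int (2 * t))" for t
    have "y (t + 2) = (int N ^ 2 + 2) * y (t + 1) - y t" for t
    proof -
      define v where "v = w @ replicate (2 * t) (1 :: int)"
      have "is_knot_braid n v" unfolding v_def by (rule is_knot_braid_twist) (use n w in auto)
      then have "homfly_at N n (v @ [1, 1, 1, 1]) (i + int (2 * (t + 2)))
          = (int N ^ 2 + 2) * homfly_at N n (v @ [1, 1]) (i + int (2 * (t + 2)) - 2)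
            - homfly_at N n v (i + int (2 * (t + 2)) - 4)"
        using n by (rule homfly_at_recurrence)
      moreover have "w @ replicate (2 * (t + 1)) 1 = v @ [1, 1]" "w @ replicate (2 * (t + 2)) 1 = v @ [1, 1, 1, 1]"
        by (simp_all add: v_def replicate_append_same[symmetric])
      moreover have "i + int (2 * (t + 2)) - 2 = i + int (2 * (t + 1))" "i + int (2 * (t + 2)) - 4 = i + int (2 * t)"
        by simp_all
      ultimately show ?thesis unfolding y_def v_def by argo
    qed
    then have "y L mod int p = y 0 mod int p" by (intro L(2)) simp
    then show "homfly_at N n (w @ replicate (2 * L) 1) (i + int (2 * L)) mod int p = homfly_at N n w i mod int p"
      by (simp add: y_def)
  qed (use L in auto)
qed

section \<open>Shifts in a, and the finiteness argument\<close>

lemma braid_equiv_untwist: "braid_equiv (w @ replicate d (- 1) @ replicate d 1) w"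
proof (induction d)
  case (Suc d)
  have "w @ replicate (Suc d) (- 1) @ replicate (Suc d) 1
      = (w @ replicate d (- 1)) @ [- 1, 1] @ replicate d (1 :: int)"
    by (simp add: replicate_append_same[symmetric])
  moreover have "braid_equiv ((w @ replicate d (- 1)) @ [- 1, 1] @ replicate d 1)
      ((w @ replicate d (- 1)) @ [] @ replicate d 1)"
    by (intro braid_equiv.basic braid_basic.cancel2) simp
  ultimately show ?case using Suc braid_equiv.trans by simp
qed (simp add: braid_equiv.refl)

lemma shift_realizable:
  fixes p :: nat
  assumes "p > 0"
  shows "\<exists>D>0. \<forall>n w (k :: int). n \<ge> 2 \<longrightarrow> is_knot_braid n w \<longrightarrow>
    (\<exists>v. is_knot_braid n v \<and>
      (\<forall>i. homfly_at N n v (i + int D * k) mod int p = homfly_at N n w i mod int p))"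
proof -
  obtain D where D: "D > 0" "even D"
    "\<And>n w i. n \<ge> 2 \<Longrightarrow> is_knot_braid n w \<Longrightarrow>
      homfly_at N n (w @ replicate D 1) (i + int D) mod int p = homfly_at N n w i mod int p"
    using twist_period[OF assms, of N] by blast
  have pos: "homfly_at N n (w @ replicate (D * k) 1) (i + int D * int k) mod int p = homfly_at N n w i mod int p"
    if "n \<ge> 2" "is_knot_braid n w" for n w i k
  proof (induction k)
    case (Suc k)
    have "is_knot_braid n (w @ replicate (D * k) 1)"
      by (rule is_knot_braid_twist) (use that D(2) in auto)
    from D(3)[OF that(1) this, of "i + int D * int k"]
    have "homfly_at N n (w @ replicate (D * Suc k) 1) (i + int D * int (Suc k)) mod int p
        = homfly_at N n (w @ replicate (D * k) 1) (i + int D * int k) mod int p"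
      by (simp add: replicate_add[symmetric] algebra_simps)
    then show ?case using Suc by simp
  qed simp
  show ?thesis
  proof (intro exI[of _ D] conjI allI impI)
    fix n w and k :: int assume n: "n \<ge> (2 :: nat)" and w: "is_knot_braid n w"
    show "\<exists>v. is_knot_braid n v \<and>
      (\<forall>i. homfly_at N n v (i + int D * k) mod int p = homfly_at N n w i mod int p)"
    proof (cases "k \<ge> 0")
      case True
      then obtain m where "k = int m" using nonneg_int_cases by blast
      then show ?thesis
        using pos[OF n w, of m] is_knot_braid_twist[OF w n, of 1 "D * m"] D(2) by auto
    next
      case False
      then have "k = - int (nat (- k))" by simp
      then obtain m where k: "k = - int m" by blast
      \<comment> \<open>For a downward shift twist negatively: \<open>w\<close> is then the positive
        twist of \<open>v\<close>, and \<open>pos\<close> is applied to \<open>v\<close>.\<close>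
      define v where "v = w @ replicate (D * m) (- 1)"
      have v: "is_knot_braid n v"
        unfolding v_def by (rule is_knot_braid_twist) (use n w D(2) in auto)
      have "homfly n (v @ replicate (D * m) 1) = homfly n w"
      proof (rule is_homfly_equiv[OF is_homfly_homfly])
        show "braid_equiv (v @ replicate (D * m) 1) w"
          using braid_equiv_untwist[of w "D * m"] by (simp add: v_def)
        show "valid_braid n w" using w by (simp add: is_knot_braid_def)
        have "is_knot_braid n (v @ replicate (D * m) 1)"
          by (rule is_knot_braid_twist) (use n v D(2) in auto)
        then show "valid_braid n (v @ replicate (D * m) 1)" by (simp add: is_knot_braid_def)
      qed
      then have "homfly_at N n (v @ replicate (D * m) 1) i = homfly_at N n w i" for i
        by (simp add: homfly_at_def)
      then have "homfly_at N n v (i + int D * k) mod int p = homfly_at N n w i mod int p" for i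
        using pos[OF n v, of m "i + int D * k"] by (simp add: k)
      then show ?thesis using v by blast
    qed
  qed (rule D(1))
qed

theorem theorem2:
  fixes N S p :: nat
  assumes "prime p"
  shows "\<exists>T::nat. \<forall>n w.
           is_knot_braid n w \<and> nonzero_mod p (homfly_at N n w) \<and>
           a_span_mod p (homfly_at N n w) \<le> int S \<longrightarrow>
           (\<exists>n' w'. is_knot_braid n' w' \<and> n' \<le> T \<and>
              (\<forall>i. homfly_at N n' w' i mod int p = homfly_at N n w i mod int p))"
proof -
  have p: "p > 0" using assms by (simp add: prime_gt_0_nat)
  obtain D where D: "D > 0"
    "\<And>n w (k :: int). n \<ge> 2 \<Longrightarrow> is_knot_braid n w \<Longrightarrow> \<exists>v. is_knot_braid n v \<and>
      (\<forall>i. homfly_at N n v (i + int D * k) mod int p = homfly_at N n w i mod int p)"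
    using shift_realizable[OF p, of N] by blast
  \<comment> \<open>The normal forms: a shift by a multiple of \<open>D\<close> brings the lowest
    exponent into [0, D), and the span then keeps the support within the window.\<close>
  define G :: "(int \<Rightarrow> int) set" where
    "G = {g. (\<forall>i. g i \<in> {0..<int p}) \<and> (\<forall>i. i \<notin> {0..int D + int S} \<longrightarrow> g i = 0)}"
  have "finite G"
    unfolding G_def by (rule finite_subset[OF _ finite_set_of_finite_funs[of "{0..int D + int S}" "{0..<int p}" 0]]) auto
  define realizes where
    "realizes g n = (n \<ge> 2 \<and> (\<exists>w. is_knot_braid n w \<and> (\<forall>i. homfly_at N n w i mod int p = g i)))" for g n
  \<comment> \<open>A sum bounds each of its terms. Forms that no knot realises contribute an
    arbitrary number, which does no harm, and \<open>Suc\<close> covers knots given on one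
    strand.\<close>
  define T where "T = Suc (\<Sum>g\<in>G. LEAST n. realizes g n)"
  have least: "(LEAST n. realizes g n) \<le> T" if "g \<in> G" for g
    using member_le_sum[of g G "\<lambda>g. LEAST n. realizes g n"] that \<open>finite G\<close> by (simp add: T_def)
  show ?thesis
  proof (rule exI[of _ T], intro allI impI)
    fix n w
    assume asm: "is_knot_braid n w \<and> nonzero_mod p (homfly_at N n w) \<and>
      a_span_mod p (homfly_at N n w) \<le> int S"
    then have w: "is_knot_braid n w" by blast
    show "\<exists>n' w'. is_knot_braid n' w' \<and> n' \<le> T \<and>
        (\<forall>i. homfly_at N n' w' i mod int p = homfly_at N n w i mod int p)"
    proof (cases "n \<ge> 2")
      case False
      then have "n \<le> T" by (simp add: T_def)
      then show ?thesis using w by blast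
    next
      case True
      define A where "A = {i. homfly_at N n w i mod int p \<noteq> 0}"
      have A: "finite A" "A \<noteq> {}"
        using asm by (auto simp: A_def nonzero_mod_def intro: finite_subset[OF _ homfly_finite_a[of N n w]])
      have span: "Max A - Min A \<le> int S" using asm by (simp add: a_span_mod_def A_def)
      \<comment> \<open>Shifting down by \<open>D * k\<close> moves \<open>Min A\<close> to its
        residue modulo \<open>D\<close>.\<close>
      define k where "k = Min A div int D"
      obtain v where v: "is_knot_braid n v"
        "\<And>i. homfly_at N n v (i + int D * (- k)) mod int p = homfly_at N n w i mod int p"
        using D(2)[OF True w, of "- k"] by blast
      define g where "g i = homfly_at N n v i mod int p" for i
      have gw: "g i = homfly_at N n w (i + int D * k) mod int p" for i
        using v(2)[of "i + int D * k"] by (simp add: g_def)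
      have "g i = 0" if "i \<notin> {0..int D + int S}" for i
      proof (rule ccontr)
        assume "g i \<noteq> 0"
        then have "i + int D * k \<in> A" by (simp add: A_def gw)
        then have "Min A \<le> i + int D * k" "i + int D * k \<le> Max A" using A by simp_all
        moreover have "Min A = int D * k + Min A mod int D" by (simp add: k_def)
        moreover have "0 \<le> Min A mod int D" "Min A mod int D < int D" using D(1) by simp_all
        ultimately show False using that span by simp
      qed
      then have G: "g \<in> G" using p by (simp add: G_def g_def)
      have "realizes g n" using True v(1) by (auto simp: realizes_def g_def)
      then have "realizes g (LEAST n. realizes g n)" by (rule LeastI)
      then obtain n' u where n': "n' = (LEAST n. realizes g n)" "n' \<ge> 2" "is_knot_braid n' u"
        "\<And>i. homfly_at N n' u i mod int p = g i"
        by (auto simp: realizes_def)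
      \<comment> \<open>The chosen representative is shifted back to the original degrees, on the
        same number of strands.\<close>
      obtain w' where w': "is_knot_braid n' w'"
        "\<And>i. homfly_at N n' w' (i + int D * k) mod int p = homfly_at N n' u i mod int p"
        using D(2)[OF n'(2,3), of k] by blast
      have "homfly_at N n' w' i mod int p = homfly_at N n w i mod int p" for i
        using w'(2)[of "i - int D * k"] n'(4)[of "i - int D * k"] gw[of "i - int D * k"] by simp
      then show ?thesis using w'(1) least[OF G] n'(1) by blast
    qed
  qed
qed

end
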